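(* Let $(M,p_0)$ be a based metric space that is Lipschitz path connected and has more than one element, such that endpoint projection $\pi:(\mathcal{P}_M,[p_0])\to(M,p_0)$ satisfies the unique lifting property and the universal path space $\mathcal{P}_M$ (with the lifted pseudo-metric $d_{\mathcal{P}}$) is a metric space. Let $(E,e_0)$ be a based Lipschitz simply connected quasi-convex metric space. Suppose that $r:(E,e_0)\to(M,p_0)$ is a based Lipschitz map satisfying the unique lifting property. Then the metric spaces $E$ and $\mathcal{P}_M$ are biLipschitz equivalent over $M$: there is a based biLipschitz bijection $\Phi:(E,e_0)\to(\mathcal{P}_M,[p_0])$ with $\pi\circ\Phi=r$. If, in addition, $M$ is a geodesic space, $E$ is a length space, $\mathrm{Lip}(r)=1$, and for any based Lipschitz map $f:(X,x_0)\to(M,p_0)$ whose domain $X$ is a length space and which induces the trivial homomorphism $f_\#$, the lift $\widehat{f}$ of $f$ with respect to $r:E\to M$ satisfies $\mathrm{Lip}(\widehat{f})=\mathrm{Lip}(f)$, then $E$ and $\mathcal{P}_M$ are isometric.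
   Context: All paths and loops are Lipschitz with domain $I=[0,1]$ (Euclidean metric); $\ell(\gamma)$ is the length of $\gamma$, $\overline{\gamma}$ the inverse path, $*$ concatenation. A metric space is Lipschitz path connected if any two points are joined by a Lipschitz path. $\mathrm{Lip}(f)$ denotes the (least) Lipschitz constant of $f$. $I\times I$ carries the $L^1$ metric. Two paths $\gamma,\gamma'$ in $M$ with the same initial points and the same end points are homotopic rel endpoints, $\gamma\simeq\gamma'$, if there is a Lipschitz map $H:I\times I\to M$ with $H|_{I\times\{0\}}=\gamma$, $H|_{I\times\{1\}}=\gamma'$, $H|_{\{0\}\times I}\equiv\gamma(0)$, $H|_{\{1\}\times I}\equiv\gamma(1)$; $[\gamma]$ denotes the class of $\gamma$. The first Lipschitz homotopy group $\pi_1^{\mathrm{Lip}}(M,p_0)$ is the set of classes of loops based at $p_0$ with group operation given by concatenation; a based Lipschitz map $f:(X,x_0)\to(M,p_0)$ induces $f_\#:\pi_1^{\mathrm{Lip}}(X,x_0)\to\pi_1^{\mathrm{Lip}}(M,p_0)$, $f_\#[\alpha]=[f\circ\alpha]$. A space is Lipschitz simply connected if it is Lipschitz path connected and its first Lipschitz homotopy group is trivial. The universal (Lipschitz) path space of $(M,p_0)$ is $\mathcal{P}_M=\{[\gamma] : \gamma:I\to M \text{ Lipschitz},\ \gamma(0)=p_0\}$, with base point $[p_0]$ (the class of the constant loop) and lifted pseudo-metric $d_{\mathcal{P}}([\gamma_1],[\gamma_2])=\inf\{\ell(\beta):\beta\simeq\overline{\gamma_1}*\gamma_2\}$. Endpoint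 projection is $\pi:\mathcal{P}_M\to M$, $\pi([\gamma])=\gamma(1)$. A metric space $(X,d)$ is quasi-convex if there is $C\ge1$ such that any $x_1,x_2\in X$ are joined by a Lipschitz path $\gamma$ with $\ell(\gamma)\le C\,d(x_1,x_2)$; it is a geodesic space if $C=1$ works, and a length space if every $C>1$ works. A based Lipschitz map $r:(E,e_0)\to(M,p_0)$ satisfies the unique lifting property if for every based quasi-convex metric space $(X,x_0)$ and every based Lipschitz map $f:(X,x_0)\to(M,p_0)$ such that $f_\#$ is trivial, there exists a unique based Lipschitz map $\widehat f:(X,x_0)\to(E,e_0)$ with $r\circ\widehat f=f$; this $\widehat f$ is called the lift of $f$ with respect to $r$. *)

theory Defs
  imports "HOL-Analysis.Analysis" "HOL-Algebra.Elementary_Groups"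
begin

section \<open>Lipschitz paths\<close>

text \<open>A path is a total function on the reals of which only the values on \<open>[0,1]\<close> matter.\<close>

definition lip_path :: "'a metric \<Rightarrow> (real \<Rightarrow> 'a) \<Rightarrow> bool" where
  "lip_path X \<gamma> \<longleftrightarrow> Lipschitz_continuous_map (submetric euclidean_metric {0..1}) X \<gamma>"

text \<open>The length is the supremum of the variation sums over all partitions of \<open>[0,1]\<close>.
  These sums are bounded when \<open>\<gamma>\<close> is Lipschitz; for other functions the real-valued supremum
  need not be meaningful, but it is never used there.\<close>

definition path_len :: "'a metric \<Rightarrow> (real \<Rightarrow> 'a) \<Rightarrow> real" where
  "path_len X \<gamma> =
     Sup {\<Sum>i<n. mdist X (\<gamma> (t i)) (\<gamma> (t (Suc i))) | (t :: nat \<Rightarrow> real) n.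
            t 0 = 0 \<and> t n = 1 \<and> (\<forall>i<n. t i \<le> t (Suc i))}"

definition inverse_path :: "(real \<Rightarrow> 'a) \<Rightarrow> real \<Rightarrow> 'a" where
  "inverse_path \<gamma> = (\<lambda>t. \<gamma> (1 - t))"

definition concat_path :: "(real \<Rightarrow> 'a) \<Rightarrow> (real \<Rightarrow> 'a) \<Rightarrow> real \<Rightarrow> 'a" where
  "concat_path \<gamma> \<delta> = (\<lambda>t. if t \<le> 1/2 then \<gamma> (2 * t) else \<delta> (2 * t - 1))"

definition lip_path_connected :: "'a metric \<Rightarrow> bool" where
  "lip_path_connected X \<longleftrightarrow>
     (\<forall>x\<in>mspace X. \<forall>y\<in>mspace X. \<exists>\<gamma>. lip_path X \<gamma> \<and> \<gamma> 0 = x \<and> \<gamma> 1 = y)"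

definition quasi_convex_with :: "real \<Rightarrow> 'a metric \<Rightarrow> bool" where
  "quasi_convex_with C X \<longleftrightarrow>
     (\<forall>x\<in>mspace X. \<forall>y\<in>mspace X.
        \<exists>\<gamma>. lip_path X \<gamma> \<and> \<gamma> 0 = x \<and> \<gamma> 1 = y \<and> path_len X \<gamma> \<le> C * mdist X x y)"

definition quasi_convex :: "'a metric \<Rightarrow> bool" where
  "quasi_convex X \<longleftrightarrow> (\<exists>C\<ge>1. quasi_convex_with C X)"

definition geodesic_space :: "'a metric \<Rightarrow> bool" where
  "geodesic_space X \<longleftrightarrow> quasi_convex_with 1 X"

definition length_space :: "'a metric \<Rightarrow> bool" where
  "length_space X \<longleftrightarrow> (\<forall>C>1. quasi_convex_with C X)"


section \<open>Lipschitz homotopy and the first Lipschitz homotopy group\<close>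

definition unit_square_L1 :: "(real \<times> real) metric" where
  "unit_square_L1 =
     metric ({0..1} \<times> {0..1}, \<lambda>p q. \<bar>fst p - fst q\<bar> + \<bar>snd p - snd q\<bar>)"

lemma Metric_space_unit_square_L1:
  "Metric_space ({0..1} \<times> {0..1}) (\<lambda>(p::real \<times> real) q. \<bar>fst p - fst q\<bar> + \<bar>snd p - snd q\<bar>)"
  by unfold_locales auto

lemma mspace_unit_square_L1 [simp]: "mspace unit_square_L1 = {0..1} \<times> {0..1}"
  unfolding unit_square_L1_def
  by (rule Metric_space.mspace_metric [OF Metric_space_unit_square_L1])

lemma mdist_unit_square_L1 [simp]:
  "mdist unit_square_L1 p q = \<bar>fst p - fst q\<bar> + \<bar>snd p - snd q\<bar>"
  unfolding unit_square_L1_def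
  by (simp add: Metric_space.mdist_metric [OF Metric_space_unit_square_L1])

definition lip_homotopic :: "'a metric \<Rightarrow> (real \<Rightarrow> 'a) \<Rightarrow> (real \<Rightarrow> 'a) \<Rightarrow> bool" where
  "lip_homotopic X \<gamma> \<gamma>' \<longleftrightarrow>
     lip_path X \<gamma> \<and> lip_path X \<gamma>' \<and> \<gamma> 0 = \<gamma>' 0 \<and> \<gamma> 1 = \<gamma>' 1 \<and>
     (\<exists>H. Lipschitz_continuous_map unit_square_L1 X H \<and>
        (\<forall>s\<in>{0..1}. H (s, 0) = \<gamma> s \<and> H (s, 1) = \<gamma>' s) \<and>
        (\<forall>t\<in>{0..1}. H (0, t) = \<gamma> 0 \<and> H (1, t) = \<gamma> 1))"

definition lip_class :: "'a metric \<Rightarrow> (real \<Rightarrow> 'a) \<Rightarrow> (real \<Rightarrow> 'a) set" where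
  "lip_class X \<gamma> = {\<gamma>'. lip_homotopic X \<gamma> \<gamma>'}"

text \<open>Products of classes and induced maps on classes are formed by taking all
  representatives, so that the result is again a class and no representative is chosen.\<close>

definition lip_pi1 :: "'a metric \<Rightarrow> 'a \<Rightarrow> (real \<Rightarrow> 'a) set monoid" where
  "lip_pi1 X x0 =
     \<lparr>carrier = {lip_class X \<alpha> | \<alpha>. lip_path X \<alpha> \<and> \<alpha> 0 = x0 \<and> \<alpha> 1 = x0},
      mult = (\<lambda>A B. \<Union>\<alpha>\<in>A. \<Union>\<beta>\<in>B. lip_class X (concat_path \<alpha> \<beta>)),
      one = lip_class X (\<lambda>_. x0)\<rparr>"

definition induced_map :: "'b metric \<Rightarrow> ('a \<Rightarrow> 'b) \<Rightarrow> (real \<Rightarrow> 'a) set \<Rightarrow> (real \<Rightarrow> 'b) set" where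
  "induced_map Y f A = (\<Union>\<alpha>\<in>A. lip_class Y (f \<circ> \<alpha>))"

definition induces_trivial ::
    "'a metric \<Rightarrow> 'a \<Rightarrow> 'b metric \<Rightarrow> 'b \<Rightarrow> ('a \<Rightarrow> 'b) \<Rightarrow> bool" where
  "induces_trivial X x0 Y y0 f \<longleftrightarrow>
     trivial_homomorphism (lip_pi1 X x0) (lip_pi1 Y y0) (induced_map Y f)"

definition lip_simply_connected :: "'a metric \<Rightarrow> bool" where
  "lip_simply_connected X \<longleftrightarrow>
     lip_path_connected X \<and> (\<forall>x\<in>mspace X. trivial_group (lip_pi1 X x))"


section \<open>Lipschitz maps between based metric spaces\<close>

definition based_lip_map ::
    "'a metric \<Rightarrow> 'a \<Rightarrow> 'b metric \<Rightarrow> 'b \<Rightarrow> ('a \<Rightarrow> 'b) \<Rightarrow> bool" where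
  "based_lip_map X x0 Y y0 f \<longleftrightarrow>
     x0 \<in> mspace X \<and> y0 \<in> mspace Y \<and> Lipschitz_continuous_map X Y f \<and> f x0 = y0"

definition lip_const :: "'a metric \<Rightarrow> 'b metric \<Rightarrow> ('a \<Rightarrow> 'b) \<Rightarrow> real" where
  "lip_const X Y f =
     Inf {L. 0 \<le> L \<and> (\<forall>x\<in>mspace X. \<forall>y\<in>mspace X. mdist Y (f x) (f y) \<le> L * mdist X x y)}"

definition biLipschitz_bijection :: "'a metric \<Rightarrow> 'b metric \<Rightarrow> ('a \<Rightarrow> 'b) \<Rightarrow> bool" where
  "biLipschitz_bijection X Y \<Phi> \<longleftrightarrow>
     bij_betw \<Phi> (mspace X) (mspace Y) \<and>
     Lipschitz_continuous_map X Y \<Phi> \<and>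
     Lipschitz_continuous_map Y X (inv_into (mspace X) \<Phi>)"

definition isometric_spaces :: "'a metric \<Rightarrow> 'b metric \<Rightarrow> bool" where
  "isometric_spaces X Y \<longleftrightarrow>
     (\<exists>\<Phi>. bij_betw \<Phi> (mspace X) (mspace Y) \<and>
        (\<forall>x\<in>mspace X. \<forall>y\<in>mspace X. mdist Y (\<Phi> x) (\<Phi> y) = mdist X x y))"


section \<open>Lifts\<close>

definition is_lift ::
    "'x metric \<Rightarrow> 'x \<Rightarrow> 'e metric \<Rightarrow> 'e \<Rightarrow> ('e \<Rightarrow> 'm) \<Rightarrow> ('x \<Rightarrow> 'm) \<Rightarrow> ('x \<Rightarrow> 'e) \<Rightarrow> bool" where
  "is_lift X x0 E e0 r f g \<longleftrightarrow>
     based_lip_map X x0 E e0 g \<and> (\<forall>x\<in>mspace X. r (g x) = f x)"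

text \<open>HOL cannot quantify over types inside a formula, so the type \<open>'x\<close> in which the
  test spaces live is a parameter; the test spaces are all quasi-convex metric spaces whose
  points form a subset of \<open>'x\<close>. Uniqueness is meant on the points of the test space.\<close>

definition unique_lifting_property ::
    "'x itself \<Rightarrow> 'e metric \<Rightarrow> 'e \<Rightarrow> 'm metric \<Rightarrow> 'm \<Rightarrow> ('e \<Rightarrow> 'm) \<Rightarrow> bool" where
  "unique_lifting_property _ E e0 M p0 r \<longleftrightarrow>
     (\<forall>(X :: 'x metric) x0 f.
        quasi_convex X \<and> based_lip_map X x0 M p0 f \<and> induces_trivial X x0 M p0 f \<longrightarrow>
        (\<exists>g. is_lift X x0 E e0 r f g) \<and>
        (\<forall>g h. is_lift X x0 E e0 r f g \<and> is_lift X x0 E e0 r f h \<longrightarrow>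
           (\<forall>x\<in>mspace X. g x = h x)))"

text \<open>For every based Lipschitz \<open>f\<close> from a length space (again in the type \<open>'x\<close>) inducing the
  trivial homomorphism, the lift of \<open>f\<close> has the same Lipschitz constant as \<open>f\<close>.\<close>

definition lifts_preserve_Lip ::
    "'x itself \<Rightarrow> 'e metric \<Rightarrow> 'e \<Rightarrow> 'm metric \<Rightarrow> 'm \<Rightarrow> ('e \<Rightarrow> 'm) \<Rightarrow> bool" where
  "lifts_preserve_Lip _ E e0 M p0 r \<longleftrightarrow>
     (\<forall>(X :: 'x metric) x0 f g.
        length_space X \<and> based_lip_map X x0 M p0 f \<and> induces_trivial X x0 M p0 f \<and>
        is_lift X x0 E e0 r f g \<longrightarrow> lip_const X E g = lip_const X M f)"


section \<open>The universal Lipschitz path space\<close>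

definition path_space :: "'m metric \<Rightarrow> 'm \<Rightarrow> (real \<Rightarrow> 'm) set set" where
  "path_space M p0 = {lip_class M \<gamma> | \<gamma>. lip_path M \<gamma> \<and> \<gamma> 0 = p0}"

definition path_space_base :: "'m metric \<Rightarrow> 'm \<Rightarrow> (real \<Rightarrow> 'm) set" where
  "path_space_base M p0 = lip_class M (\<lambda>_. p0)"

text \<open>The infimum is taken over all representatives of the two classes, which all yield the same
  set of paths \<open>\<beta>\<close>. The value \<open>0\<close> off the path space is there only because the locale
  \<^locale>\<open>Metric_space\<close> requires nonnegativity also outside the carrier.\<close>

definition lifted_dist ::
    "'m metric \<Rightarrow> 'm \<Rightarrow> (real \<Rightarrow> 'm) set \<Rightarrow> (real \<Rightarrow> 'm) set \<Rightarrow> real" where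
  "lifted_dist M p0 A B =
     (if A \<in> path_space M p0 \<and> B \<in> path_space M p0
      then Inf {path_len M \<beta> | \<beta> \<gamma>1 \<gamma>2.
                  \<gamma>1 \<in> A \<and> \<gamma>2 \<in> B \<and> lip_homotopic M \<beta> (concat_path (inverse_path \<gamma>1) \<gamma>2)}
      else 0)"

text \<open>By the definition of \<^const>\<open>metric\<close> this is meaningful only when
  \<^const>\<open>lifted_dist\<close> is a metric on the path space.\<close>

definition path_space_metric :: "'m metric \<Rightarrow> 'm \<Rightarrow> (real \<Rightarrow> 'm) set metric" where
  "path_space_metric M p0 = metric (path_space M p0, lifted_dist M p0)"

text \<open>All paths in a class have the same endpoint.\<close>

definition endpoint_proj :: "(real \<Rightarrow> 'm) set \<Rightarrow> 'm" where
  "endpoint_proj A = (THE p. \<exists>\<gamma>\<in>A. p = \<gamma> 1)"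

text \<open>The type of the points of the test spaces. It contains copies of all subspaces of \<open>E\<close>, of
  the path space and, as soon as \<open>'m\<close> has two elements, of the real line. Requiring the lifting
  properties for test spaces in this type only is a weaker hypothesis than requiring them for all
  quasi-convex metric spaces.\<close>

type_synonym ('e, 'm) test_point = "'e + (real \<Rightarrow> 'm) set"

end

theory Submission
  imports Defs
begin

text \<open>
  Two spaces over \<open>M\<close> that both have the unique lifting property are isomorphic over \<open>M\<close> as soon as
  the projection of each can be lifted to the other: the two lifts are inverse to each other, because
  their composites and the identities are lifts of the same maps. To apply this to \<open>r\<close> and the
  endpoint projection, both must induce trivial homomorphisms and both domains must be quasi-convex.

  For \<open>r\<close> this is clear, since \<open>E\<close> is simply connected and quasi-convex. In the path space, the
  truncations of a path \<open>\<gamma>\<close> in \<open>M\<close> form a path which is not longer than \<open>\<gamma>\<close>, by superadditivity of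
  length. Such paths, taken over almost shortest connecting paths, show that the path space is even
  a length space (\<open>length_space_P\<close>). A loop in the path space coincides with the truncations of its
  projection, as both lift the projection; at the end time this says that the class of the projected
  loop is the base point, so that the projected loop is null-homotopic (\<open>endpoint_null_on_loops\<close>). So path lifting replaces any computation of the
  fundamental group of the path space.

  The map \<open>\<Phi>\<close> from \<open>E\<close> to the path space is written down explicitly: \<open>x\<close> goes to the class of \<open>r \<circ> \<alpha>\<close>
  for any path \<open>\<alpha>\<close> from the base point to \<open>x\<close> (\<open>path_class_map\<close>). The distance of two values is at most
  the length of \<open>r \<circ> \<gamma>\<close> for any path \<open>\<gamma>\<close> between the two points, so \<open>\<Phi>\<close> is Lipschitz if \<open>E\<close> is
  quasi-convex, and 1-Lipschitz if \<open>E\<close> is a length space and \<open>Lip(r) = 1\<close>. The map in the other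
  direction is the lift \<open>\<Psi>\<close> of the endpoint projection with respect to \<open>r\<close>. Endpoint projection is
  1-Lipschitz, so if lifts preserve Lipschitz constants, then \<open>\<Psi>\<close> is 1-Lipschitz too. A
  1-Lipschitz bijection with 1-Lipschitz inverse is an isometry.
\<close>

abbreviation unit_interval :: "real metric" where
  "unit_interval \<equiv> submetric euclidean_metric {0..1}"

section \<open>Lipschitz maps and gluing\<close>

lemma Lipschitz_continuous_mapI:
  assumes "\<And>x. x \<in> mspace X \<Longrightarrow> f x \<in> mspace Y"
    and "\<And>x y. \<lbrakk>x \<in> mspace X; y \<in> mspace X\<rbrakk> \<Longrightarrow> mdist Y (f x) (f y) \<le> L * mdist X x y"
  shows "Lipschitz_continuous_map X Y f"
  using assms unfolding Lipschitz_continuous_map_def by blast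

lemma lip_pathI:
  assumes "\<And>t. t \<in> {0..1} \<Longrightarrow> \<gamma> t \<in> mspace X"
    and "\<And>s t. \<lbrakk>s \<in> {0..1}; t \<in> {0..1}; s \<le> t\<rbrakk> \<Longrightarrow> mdist X (\<gamma> s) (\<gamma> t) \<le> L * (t - s)"
  shows "lip_path X \<gamma>"
  unfolding lip_path_def
proof (rule Lipschitz_continuous_mapI[where L = L])
  fix s t assume st: "s \<in> mspace unit_interval" "t \<in> mspace unit_interval"
  show "mdist X (\<gamma> s) (\<gamma> t) \<le> L * mdist unit_interval s t"
    using st assms(2)[of s t] assms(2)[of t s]
    by (cases "s \<le> t") (auto simp: dist_real_def mdist_commute)
qed (use assms in auto)

lemma lip_pathE:
  assumes "lip_path X \<gamma>"
  obtains L where "L \<ge> 0" "\<And>s t. \<lbrakk>s \<in> {0..1}; t \<in> {0..1}\<rbrakk> \<Longrightarrow> mdist X (\<gamma> s) (\<gamma> t) \<le> L * \<bar>s - t\<bar>"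
proof -
  obtain L where "L > 0" "\<And>s t. \<lbrakk>s \<in> {0..1}; t \<in> {0..1}\<rbrakk> \<Longrightarrow> mdist X (\<gamma> s) (\<gamma> t) \<le> L * \<bar>s - t\<bar>"
    using assms unfolding lip_path_def Lipschitz_continuous_map_pos
    by (auto simp: dist_real_def)
  then show thesis by (intro that[of L]) auto
qed

lemma lip_path_in_mspace:
  "\<lbrakk>lip_path X \<gamma>; t \<in> {0..1}\<rbrakk> \<Longrightarrow> \<gamma> t \<in> mspace X"
  unfolding lip_path_def Lipschitz_continuous_map_def by (auto simp: Pi_iff)

lemma lip_path_const: "x \<in> mspace X \<Longrightarrow> lip_path X (\<lambda>_. x)"
  by (rule lip_pathI[where L = 0]) (auto intro!: eq_refl)

lemma lip_path_compose:
  "\<lbrakk>lip_path X \<gamma>; Lipschitz_continuous_map X Y f\<rbrakk> \<Longrightarrow> lip_path Y (f \<circ> \<gamma>)"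
  unfolding lip_path_def by (rule Lipschitz_continuous_map_compose)

lemma lip_path_reparam:
  "\<lbrakk>lip_path X \<gamma>; lip_path unit_interval \<phi>\<rbrakk> \<Longrightarrow> lip_path X (\<gamma> \<circ> \<phi>)"
  by (rule lip_path_compose) (auto simp: lip_path_def)

lemma lip_path_cong:
  "\<lbrakk>lip_path X \<gamma>; \<And>t. t \<in> {0..1} \<Longrightarrow> \<gamma> t = \<delta> t\<rbrakk> \<Longrightarrow> lip_path X \<delta>"
  unfolding lip_path_def by (erule Lipschitz_continuous_map_eq) auto

text \<open>Two Lipschitz maps that agree on an overlap need not glue to a Lipschitz map in general. They do
when every pair of points from different pieces has a point of the overlap metrically between
them, for then the two Lipschitz estimates add up through that point. This holds for an interval
cut at a point and, because of the \<open>L\<^sup>1\<close> metric, for the unit square cut along a line parallel to a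
side; all concatenations of paths and of homotopies below are of this kind.\<close>
lemma Lipschitz_glue:
  assumes cover: "mspace X \<subseteq> A \<union> B"
    and fA: "Lipschitz_continuous_map (submetric X A) Y f"
    and fB: "Lipschitz_continuous_map (submetric X B) Y f"
    and between: "\<And>a b. \<lbrakk>a \<in> A \<inter> mspace X; b \<in> B \<inter> mspace X\<rbrakk> \<Longrightarrow>
        \<exists>m \<in> A \<inter> B \<inter> mspace X. mdist X a m + mdist X m b \<le> mdist X a b"
  shows "Lipschitz_continuous_map X Y f"
proof -
  obtain K where K: "K > 0" "\<And>x y. \<lbrakk>x \<in> A \<inter> mspace X; y \<in> A \<inter> mspace X\<rbrakk> \<Longrightarrow>
      mdist Y (f x) (f y) \<le> K * mdist X x y"
    using fA unfolding Lipschitz_continuous_map_pos by auto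
  obtain L where L: "L > 0" "\<And>x y. \<lbrakk>x \<in> B \<inter> mspace X; y \<in> B \<inter> mspace X\<rbrakk> \<Longrightarrow>
      mdist Y (f x) (f y) \<le> L * mdist X x y"
    using fB unfolding Lipschitz_continuous_map_pos by auto
  have fin: "f x \<in> mspace Y" if "x \<in> mspace X" for x
    using fA fB cover that unfolding Lipschitz_continuous_map_def by (auto simp: Pi_iff)
  define C where "C = max K L"
  have CA: "mdist Y (f x) (f y) \<le> C * mdist X x y" if "x \<in> A \<inter> mspace X" "y \<in> A \<inter> mspace X" for x y
    using K(2)[OF that] mult_right_mono[of K C "mdist X x y"] by (simp add: C_def)
  have CB: "mdist Y (f x) (f y) \<le> C * mdist X x y" if "x \<in> B \<inter> mspace X" "y \<in> B \<inter> mspace X" for x y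
    using L(2)[OF that] mult_right_mono[of L C "mdist X x y"] by (simp add: C_def)
  have mixed: "mdist Y (f a) (f b) \<le> C * mdist X a b" if ab: "a \<in> A \<inter> mspace X" "b \<in> B \<inter> mspace X" for a b
  proof -
    obtain m where m: "m \<in> A \<inter> B \<inter> mspace X" "mdist X a m + mdist X m b \<le> mdist X a b"
      using between[OF ab] by blast
    have "mdist Y (f a) (f b) \<le> mdist Y (f a) (f m) + mdist Y (f m) (f b)"
      using ab m fin by (intro mdist_triangle) auto
    also have "\<dots> \<le> C * mdist X a m + C * mdist X m b"
      using CA[of a m] CB[of m b] ab m by auto
    also have "\<dots> \<le> C * mdist X a b"
      using m(2) K(1) mult_left_mono[of "mdist X a m + mdist X m b" "mdist X a b" C]
      by (auto simp: C_def distrib_left)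
    finally show ?thesis .
  qed
  show ?thesis
  proof (rule Lipschitz_continuous_mapI[where L = C])
    fix x y assume xy: "x \<in> mspace X" "y \<in> mspace X"
    then show "mdist Y (f x) (f y) \<le> C * mdist X x y"
      using cover CA[of x y] CB[of x y] mixed[of x y] mixed[of y x]
      by (auto simp: mdist_commute)
  qed (rule fin)
qed

lemma lip_path_concat:
  assumes "lip_path X \<gamma>" "lip_path X \<delta>" "\<gamma> 1 = \<delta> 0"
  shows "lip_path X (concat_path \<gamma> \<delta>)"
  unfolding lip_path_def
proof (rule Lipschitz_glue[where A = "{0..1/2}" and B = "{1/2..1}"])
  have "Lipschitz_continuous_map (submetric unit_interval {0..1/2}) X (\<gamma> \<circ> (\<lambda>t. 2 * t))"
    by (rule Lipschitz_continuous_map_compose[OF _ assms(1)[unfolded lip_path_def]],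
        rule Lipschitz_continuous_mapI[where L = 2]) (auto simp: dist_real_def abs_if)
  then show "Lipschitz_continuous_map (submetric unit_interval {0..1/2}) X (concat_path \<gamma> \<delta>)"
    by (rule Lipschitz_continuous_map_eq) (auto simp: concat_path_def)
  have "Lipschitz_continuous_map (submetric unit_interval {1/2..1}) X (\<delta> \<circ> (\<lambda>t. 2 * t - 1))"
    by (rule Lipschitz_continuous_map_compose[OF _ assms(2)[unfolded lip_path_def]],
        rule Lipschitz_continuous_mapI[where L = 2]) (auto simp: dist_real_def abs_if)
  then show "Lipschitz_continuous_map (submetric unit_interval {1/2..1}) X (concat_path \<gamma> \<delta>)"
  proof (rule Lipschitz_continuous_map_eq)
    fix t assume "t \<in> mspace (submetric unit_interval {1/2..1::real})"
    then show "(\<delta> \<circ> (\<lambda>t. 2 * t - 1)) t = concat_path \<gamma> \<delta> t"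
    proof (cases "t = 1/2")
      case True
      show ?thesis using assms(3) by (simp add: True concat_path_def)
    qed (auto simp: concat_path_def)
  qed
  show "\<exists>m\<in>{0..1/2} \<inter> {1/2..1} \<inter> mspace unit_interval.
       mdist unit_interval a m + mdist unit_interval m b \<le> mdist unit_interval a b"
    if "a \<in> {0..1/2} \<inter> mspace unit_interval" "b \<in> {1/2..1} \<inter> mspace unit_interval" for a b
    using that by (intro bexI[of _ "1/2"]) (auto simp: dist_real_def)
qed auto

lemma lip_path_inverse: "lip_path X \<gamma> \<Longrightarrow> lip_path X (inverse_path \<gamma>)"
  using lip_path_reparam[of X \<gamma> "\<lambda>t. 1 - t"] lip_pathI[of "\<lambda>t. 1 - t" unit_interval 1]
  by (auto simp: inverse_path_def o_def dist_real_def)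

lemma inverse_path_ends [simp]: "inverse_path \<gamma> 0 = \<gamma> 1" "inverse_path \<gamma> 1 = \<gamma> 0"
  and inverse_inverse_path [simp]: "inverse_path (inverse_path \<gamma>) = \<gamma>"
  by (auto simp: inverse_path_def)

lemma concat_path_ends [simp]: "concat_path \<gamma> \<delta> 0 = \<gamma> 0" "concat_path \<gamma> \<delta> 1 = \<delta> 1"
  by (auto simp: concat_path_def)

section \<open>Homotopy of Lipschitz paths\<close>

lemma lip_homotopicD:
  assumes "lip_homotopic X \<gamma> \<delta>"
  shows "lip_path X \<gamma>" "lip_path X \<delta>" "\<gamma> 0 = \<delta> 0" "\<gamma> 1 = \<delta> 1"
  using assms by (auto simp: lip_homotopic_def)

lemma lip_homotopicI:
  assumes H: "Lipschitz_continuous_map unit_square_L1 X H"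
    and bot: "\<And>s. s \<in> {0..1} \<Longrightarrow> H (s, 0) = \<gamma> s" and top: "\<And>s. s \<in> {0..1} \<Longrightarrow> H (s, 1) = \<delta> s"
    and left: "\<And>t. t \<in> {0..1} \<Longrightarrow> H (0, t) = \<gamma> 0" and right: "\<And>t. t \<in> {0..1} \<Longrightarrow> H (1, t) = \<gamma> 1"
  shows "lip_homotopic X \<gamma> \<delta>"
proof -
  have slice: "lip_path X (\<lambda>s. H (s, t))" if "t \<in> {0..1}" for t
  proof -
    have "Lipschitz_continuous_map unit_interval unit_square_L1 (\<lambda>s. (s, t))"
      using that by (intro Lipschitz_continuous_mapI[where L = 1]) (auto simp: dist_real_def)
    from Lipschitz_continuous_map_compose[OF this H] show ?thesis
      by (simp add: lip_path_def o_def)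
  qed
  have "lip_path X \<gamma>" "lip_path X \<delta>"
    using lip_path_cong[OF slice[of 0] bot] lip_path_cong[OF slice[of 1] top] by auto
  moreover have "\<gamma> 0 = \<delta> 0" "\<gamma> 1 = \<delta> 1"
    using top[of 0] left[of 1] top[of 1] right[of 1] by auto
  ultimately show ?thesis
    unfolding lip_homotopic_def using assms by blast
qed

lemma lip_homotopicE:
  assumes "lip_homotopic X \<gamma> \<delta>"
  obtains H where "Lipschitz_continuous_map unit_square_L1 X H"
    "\<And>s. s \<in> {0..1} \<Longrightarrow> H (s, 0) = \<gamma> s" "\<And>s. s \<in> {0..1} \<Longrightarrow> H (s, 1) = \<delta> s"
    "\<And>t. t \<in> {0..1} \<Longrightarrow> H (0, t) = \<gamma> 0" "\<And>t. t \<in> {0..1} \<Longrightarrow> H (1, t) = \<gamma> 1"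
  using assms unfolding lip_homotopic_def by blast

lemma lip_homotopic_cong:
  assumes "lip_homotopic X \<gamma> \<delta>"
    and "\<And>t. t \<in> {0..1} \<Longrightarrow> \<gamma> t = \<gamma>' t" "\<And>t. t \<in> {0..1} \<Longrightarrow> \<delta> t = \<delta>' t"
  shows "lip_homotopic X \<gamma>' \<delta>'"
  using assms(1)
proof (rule lip_homotopicE)
  fix H assume H: "Lipschitz_continuous_map unit_square_L1 X H"
    "\<And>s. s \<in> {0..1} \<Longrightarrow> H (s, 0) = \<gamma> s" "\<And>s. s \<in> {0..1} \<Longrightarrow> H (s, 1) = \<delta> s"
    "\<And>t. t \<in> {0..1} \<Longrightarrow> H (0, t) = \<gamma> 0" "\<And>t. t \<in> {0..1} \<Longrightarrow> H (1, t) = \<gamma> 1"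
  show ?thesis
    by (rule lip_homotopicI[OF H(1)]) (auto simp: H assms(2,3)[symmetric])
qed

lemma lip_homotopic_compose:
  assumes "lip_homotopic X \<gamma> \<delta>" "Lipschitz_continuous_map X Y f"
  shows "lip_homotopic Y (f \<circ> \<gamma>) (f \<circ> \<delta>)"
  using assms(1)
proof (rule lip_homotopicE)
  fix H assume H: "Lipschitz_continuous_map unit_square_L1 X H"
    "\<And>s. s \<in> {0..1} \<Longrightarrow> H (s, 0) = \<gamma> s" "\<And>s. s \<in> {0..1} \<Longrightarrow> H (s, 1) = \<delta> s"
    "\<And>t. t \<in> {0..1} \<Longrightarrow> H (0, t) = \<gamma> 0" "\<And>t. t \<in> {0..1} \<Longrightarrow> H (1, t) = \<gamma> 1"
  show ?thesis
    by (rule lip_homotopicI[OF Lipschitz_continuous_map_compose[OF H(1) assms(2)]]) (auto simp: H)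
qed

text \<open>The interval is convex, so \<open>\<phi>\<close> is deformed into \<open>\<psi>\<close> along straight lines and \<open>\<gamma>\<close> is applied to this
deformation. All groupoid laws are instances: both sides of each law are reparametrizations of a
single path. The same argument shows that a map defined on an interval kills every loop.\<close>
lemma lip_homotopic_reparam:
  assumes \<gamma>: "lip_path X \<gamma>" and \<phi>: "lip_path unit_interval \<phi>" and \<psi>: "lip_path unit_interval \<psi>"
    and ends: "\<phi> 0 = \<psi> 0" "\<phi> 1 = \<psi> 1"
  shows "lip_homotopic X (\<gamma> \<circ> \<phi>) (\<gamma> \<circ> \<psi>)"
proof -
  obtain K where K: "K \<ge> 0" "\<And>s t. \<lbrakk>s \<in> {0..1}; t \<in> {0..1}\<rbrakk> \<Longrightarrow> \<bar>\<phi> s - \<phi> t\<bar> \<le> K * \<bar>s - t\<bar>"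
    using lip_pathE[OF \<phi>] by (auto simp: dist_real_def)
  obtain L where L: "L \<ge> 0" "\<And>s t. \<lbrakk>s \<in> {0..1}; t \<in> {0..1}\<rbrakk> \<Longrightarrow> \<bar>\<psi> s - \<psi> t\<bar> \<le> L * \<bar>s - t\<bar>"
    using lip_pathE[OF \<psi>] by (auto simp: dist_real_def)
  have in01: "\<phi> s \<in> {0..1}" "\<psi> s \<in> {0..1}" if "s \<in> {0..1}" for s
    using lip_path_in_mspace[OF \<phi> that] lip_path_in_mspace[OF \<psi> that] by auto
  define h where "h = (\<lambda>(s::real, t::real). (1 - t) * \<phi> s + t * \<psi> s)"
  have "Lipschitz_continuous_map unit_square_L1 unit_interval h"
  proof (rule Lipschitz_continuous_mapI[where L = "K + L + 1"])
    fix p assume "p \<in> mspace unit_square_L1"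
    then obtain s t where p: "p = (s, t)" "s \<in> {0..1}" "t \<in> {0..1}" by auto
    then show "h p \<in> mspace unit_interval"
      using in01[of s] convex_bound_le[of "\<phi> s" 1 "\<psi> s" "1 - t" t] by (auto simp: h_def)
  next
    fix p q assume "p \<in> mspace unit_square_L1" "q \<in> mspace unit_square_L1"
    then obtain s t s' t' where p: "p = (s, t)" "s \<in> {0..1}" "t \<in> {0..1}"
      and q: "q = (s', t')" "s' \<in> {0..1}" "t' \<in> {0..1}" by auto
    have "h p - h q = (1 - t) * (\<phi> s - \<phi> s') + t * (\<psi> s - \<psi> s') + (t - t') * (\<psi> s' - \<phi> s')"
      by (simp add: h_def p q algebra_simps)
    then have "\<bar>h p - h q\<bar> \<le> \<bar>(1 - t) * (\<phi> s - \<phi> s')\<bar> + \<bar>t * (\<psi> s - \<psi> s')\<bar> + \<bar>(t - t') * (\<psi> s' - \<phi> s')\<bar>"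
      by linarith
    also have "\<dots> \<le> \<bar>\<phi> s - \<phi> s'\<bar> + \<bar>\<psi> s - \<psi> s'\<bar> + \<bar>t - t'\<bar>"
      using p q in01[of s'] mult_left_le_one_le[of "\<bar>\<phi> s - \<phi> s'\<bar>" "1 - t"]
        mult_left_le_one_le[of "\<bar>\<psi> s - \<psi> s'\<bar>" t]
        mult_left_le[of "\<bar>\<psi> s' - \<phi> s'\<bar>" "\<bar>t - t'\<bar>"]
      by (intro add_mono) (auto simp: abs_mult)
    also have "\<dots> \<le> K * \<bar>s - s'\<bar> + L * \<bar>s - s'\<bar> + \<bar>t - t'\<bar>"
      using K(2)[of s s'] L(2)[of s s'] p q by auto
    also have "\<dots> \<le> (K + L + 1) * (\<bar>s - s'\<bar> + \<bar>t - t'\<bar>)"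
      using K(1) L(1) by (simp add: algebra_simps)
    finally show "mdist unit_interval (h p) (h q) \<le> (K + L + 1) * mdist unit_square_L1 p q"
      by (simp add: p q dist_real_def)
  qed
  from Lipschitz_continuous_map_compose[OF this \<gamma>[unfolded lip_path_def]]
  show ?thesis
    by (rule lip_homotopicI) (auto simp: h_def ends algebra_simps)
qed

lemma lip_homotopic_refl: "lip_path X \<gamma> \<Longrightarrow> lip_homotopic X \<gamma> \<gamma>"
  using lip_homotopic_reparam[of X \<gamma> "\<lambda>t. t" "\<lambda>t. t"]
  by (auto simp: o_def lip_path_def Lipschitz_continuous_map_id)

lemma lip_homotopic_sym:
  assumes "lip_homotopic X \<gamma> \<delta>"
  shows "lip_homotopic X \<delta> \<gamma>"
  using assms
proof (rule lip_homotopicE)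
  fix H assume H: "Lipschitz_continuous_map unit_square_L1 X H"
    "\<And>s. s \<in> {0..1} \<Longrightarrow> H (s, 0) = \<gamma> s" "\<And>s. s \<in> {0..1} \<Longrightarrow> H (s, 1) = \<delta> s"
    "\<And>t. t \<in> {0..1} \<Longrightarrow> H (0, t) = \<gamma> 0" "\<And>t. t \<in> {0..1} \<Longrightarrow> H (1, t) = \<gamma> 1"
  have "Lipschitz_continuous_map unit_square_L1 unit_square_L1 (\<lambda>p. (fst p, 1 - snd p))"
    by (rule Lipschitz_continuous_mapI[where L = 1]) auto
  from Lipschitz_continuous_map_compose[OF this H(1)]
  show ?thesis
    by (rule lip_homotopicI) (auto simp: H lip_homotopicD(3,4)[OF assms])
qed

lemma lip_homotopic_trans [trans]:
  assumes 1: "lip_homotopic X \<gamma> \<delta>" and 2: "lip_homotopic X \<delta> \<epsilon>"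
  shows "lip_homotopic X \<gamma> \<epsilon>"
proof -
  obtain H where H: "Lipschitz_continuous_map unit_square_L1 X H"
    "\<And>s. s \<in> {0..1} \<Longrightarrow> H (s, 0) = \<gamma> s" "\<And>s. s \<in> {0..1} \<Longrightarrow> H (s, 1) = \<delta> s"
    "\<And>t. t \<in> {0..1} \<Longrightarrow> H (0, t) = \<gamma> 0" "\<And>t. t \<in> {0..1} \<Longrightarrow> H (1, t) = \<gamma> 1"
    using lip_homotopicE[OF 1] by blast
  obtain G where G: "Lipschitz_continuous_map unit_square_L1 X G"
    "\<And>s. s \<in> {0..1} \<Longrightarrow> G (s, 0) = \<delta> s" "\<And>s. s \<in> {0..1} \<Longrightarrow> G (s, 1) = \<epsilon> s"
    "\<And>t. t \<in> {0..1} \<Longrightarrow> G (0, t) = \<delta> 0" "\<And>t. t \<in> {0..1} \<Longrightarrow> G (1, t) = \<delta> 1"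
    using lip_homotopicE[OF 2] by blast
  define F where "F = (\<lambda>(s::real, t::real). if t \<le> 1/2 then H (s, 2 * t) else G (s, 2 * t - 1))"
  have "Lipschitz_continuous_map unit_square_L1 X F"
  proof (rule Lipschitz_glue[where A = "UNIV \<times> {0..1/2}" and B = "UNIV \<times> {1/2..1}"])
    have "Lipschitz_continuous_map (submetric unit_square_L1 (UNIV \<times> {0..1/2})) X
        (H \<circ> (\<lambda>p. (fst p, 2 * snd p)))"
      by (rule Lipschitz_continuous_map_compose[OF _ H(1)],
          rule Lipschitz_continuous_mapI[where L = 2]) (auto simp: abs_if)
    then show "Lipschitz_continuous_map (submetric unit_square_L1 (UNIV \<times> {0..1/2})) X F"
      by (rule Lipschitz_continuous_map_eq) (auto simp: F_def)
    have "Lipschitz_continuous_map (submetric unit_square_L1 (UNIV \<times> {1/2..1})) X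
        (G \<circ> (\<lambda>p. (fst p, 2 * snd p - 1)))"
      by (rule Lipschitz_continuous_map_compose[OF _ G(1)],
          rule Lipschitz_continuous_mapI[where L = 2]) (auto simp: abs_if)
    then show "Lipschitz_continuous_map (submetric unit_square_L1 (UNIV \<times> {1/2..1})) X F"
    proof (rule Lipschitz_continuous_map_eq)
      fix p :: "real \<times> real" assume p: "p \<in> mspace (submetric unit_square_L1 (UNIV \<times> {1/2..1}))"
      show "(G \<circ> (\<lambda>p. (fst p, 2 * snd p - 1))) p = F p"
      proof (cases "snd p = 1/2")
        case True
        then have "p = (fst p, 1/2)" "fst p \<in> {0..1}"
          using p by (auto simp: prod_eq_iff)
        moreover have "G (x, 0) = F (x, 1/2)" if "x \<in> {0..1}" for x
          using H(3)[OF that] G(2)[OF that] by (simp add: F_def)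
        ultimately show ?thesis by (metis (no_types, lifting) True comp_apply field_sum_of_halves mult_2 diff_self)
      qed (use p in \<open>auto simp: F_def\<close>)
    qed
    show "\<exists>m\<in>UNIV \<times> {0..1/2} \<inter> UNIV \<times> {1/2..1} \<inter> mspace unit_square_L1.
       mdist unit_square_L1 a m + mdist unit_square_L1 m b \<le> mdist unit_square_L1 a b"
      if "a \<in> UNIV \<times> {0..1/2} \<inter> mspace unit_square_L1" "b \<in> UNIV \<times> {1/2..1} \<inter> mspace unit_square_L1" for a b
      using that by (intro bexI[of _ "(fst a, 1/2)"]) auto
  qed auto
  then show ?thesis
    by (rule lip_homotopicI) (auto simp: F_def H G lip_homotopicD(3,4)[OF 1])
qed

lemma lip_homotopic_concat:
  assumes 1: "lip_homotopic X \<gamma> \<gamma>'" and 2: "lip_homotopic X \<delta> \<delta>'" and meet: "\<gamma> 1 = \<delta> 0"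
  shows "lip_homotopic X (concat_path \<gamma> \<delta>) (concat_path \<gamma>' \<delta>')"
proof -
  obtain H where H: "Lipschitz_continuous_map unit_square_L1 X H"
    "\<And>s. s \<in> {0..1} \<Longrightarrow> H (s, 0) = \<gamma> s" "\<And>s. s \<in> {0..1} \<Longrightarrow> H (s, 1) = \<gamma>' s"
    "\<And>t. t \<in> {0..1} \<Longrightarrow> H (0, t) = \<gamma> 0" "\<And>t. t \<in> {0..1} \<Longrightarrow> H (1, t) = \<gamma> 1"
    using lip_homotopicE[OF 1] by blast
  obtain G where G: "Lipschitz_continuous_map unit_square_L1 X G"
    "\<And>s. s \<in> {0..1} \<Longrightarrow> G (s, 0) = \<delta> s" "\<And>s. s \<in> {0..1} \<Longrightarrow> G (s, 1) = \<delta>' s"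
    "\<And>t. t \<in> {0..1} \<Longrightarrow> G (0, t) = \<delta> 0" "\<And>t. t \<in> {0..1} \<Longrightarrow> G (1, t) = \<delta> 1"
    using lip_homotopicE[OF 2] by blast
  define F where "F = (\<lambda>(s::real, t::real). if s \<le> 1/2 then H (2 * s, t) else G (2 * s - 1, t))"
  have "Lipschitz_continuous_map unit_square_L1 X F"
  proof (rule Lipschitz_glue[where A = "{0..1/2} \<times> UNIV" and B = "{1/2..1} \<times> UNIV"])
    have "Lipschitz_continuous_map (submetric unit_square_L1 ({0..1/2} \<times> UNIV)) X
        (H \<circ> (\<lambda>p. (2 * fst p, snd p)))"
      by (rule Lipschitz_continuous_map_compose[OF _ H(1)],
          rule Lipschitz_continuous_mapI[where L = 2]) (auto simp: abs_if)
    then show "Lipschitz_continuous_map (submetric unit_square_L1 ({0..1/2} \<times> UNIV)) X F"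
      by (rule Lipschitz_continuous_map_eq) (auto simp: F_def)
    have "Lipschitz_continuous_map (submetric unit_square_L1 ({1/2..1} \<times> UNIV)) X
        (G \<circ> (\<lambda>p. (2 * fst p - 1, snd p)))"
      by (rule Lipschitz_continuous_map_compose[OF _ G(1)],
          rule Lipschitz_continuous_mapI[where L = 2]) (auto simp: abs_if)
    then show "Lipschitz_continuous_map (submetric unit_square_L1 ({1/2..1} \<times> UNIV)) X F"
    proof (rule Lipschitz_continuous_map_eq)
      fix p :: "real \<times> real" assume p: "p \<in> mspace (submetric unit_square_L1 ({1/2..1} \<times> UNIV))"
      show "(G \<circ> (\<lambda>p. (2 * fst p - 1, snd p))) p = F p"
      proof (cases "fst p = 1/2")
        case True
        then have "p = (1/2, snd p)" "snd p \<in> {0..1}"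
          using p by (auto simp: prod_eq_iff)
        moreover have "G (0, x) = F (1/2, x)" if "x \<in> {0..1}" for x
          using H(5)[OF that] G(4)[OF that] meet by (simp add: F_def)
        ultimately show ?thesis by (metis (no_types, lifting) True comp_apply field_sum_of_halves mult_2 diff_self)
      qed (use p in \<open>auto simp: F_def\<close>)
    qed
    show "\<exists>m\<in>{0..1/2} \<times> UNIV \<inter> {1/2..1} \<times> UNIV \<inter> mspace unit_square_L1.
       mdist unit_square_L1 a m + mdist unit_square_L1 m b \<le> mdist unit_square_L1 a b"
      if "a \<in> {0..1/2} \<times> UNIV \<inter> mspace unit_square_L1" "b \<in> {1/2..1} \<times> UNIV \<inter> mspace unit_square_L1" for a b
      using that by (intro bexI[of _ "(1/2, snd a)"]) auto
  qed auto
  then show ?thesis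
    by (rule lip_homotopicI) (auto simp: F_def H G concat_path_def)
qed

section \<open>Groupoid laws up to homotopy\<close>

lemma concat_const_left:
  assumes "lip_path X \<gamma>" "x = \<gamma> 0"
  shows "lip_homotopic X (concat_path (\<lambda>_. x) \<gamma>) \<gamma>"
proof -
  have "lip_homotopic X (\<gamma> \<circ> (\<lambda>t. if t \<le> 1/2 then 0 else 2 * t - 1)) (\<gamma> \<circ> (\<lambda>t. t))"
    using assms(1) by (rule lip_homotopic_reparam)
      (auto intro!: lip_pathI[where L = 2] simp: dist_real_def abs_if)
  then show ?thesis
    by (rule lip_homotopic_cong) (auto simp: concat_path_def assms(2))
qed

lemma concat_const_right:
  assumes "lip_path X \<gamma>" "x = \<gamma> 1"
  shows "lip_homotopic X (concat_path \<gamma> (\<lambda>_. x)) \<gamma>"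
proof -
  have "lip_homotopic X (\<gamma> \<circ> (\<lambda>t. if t \<le> 1/2 then 2 * t else 1)) (\<gamma> \<circ> (\<lambda>t. t))"
    using assms(1) by (rule lip_homotopic_reparam)
      (auto intro!: lip_pathI[where L = 2] simp: dist_real_def abs_if)
  then show ?thesis
    by (rule lip_homotopic_cong) (auto simp: concat_path_def assms(2))
qed

text \<open>The path runs along \<open>\<gamma>\<close> with a tent function as parameter, and the tent contracts to \<open>0\<close>.\<close>
lemma concat_inverse_right:
  assumes "lip_path X \<gamma>"
  shows "lip_homotopic X (concat_path \<gamma> (inverse_path \<gamma>)) (\<lambda>_. \<gamma> 0)"
proof -
  have "lip_homotopic X (\<gamma> \<circ> (\<lambda>t. min (2 * t) (2 - 2 * t))) (\<gamma> \<circ> (\<lambda>t. 0))"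
    using assms by (rule lip_homotopic_reparam)
      (auto intro!: lip_pathI[where L = 2] simp: dist_real_def min_def)
  then show ?thesis
    by (rule lip_homotopic_cong) (auto simp: concat_path_def inverse_path_def min_def algebra_simps)
qed

lemma concat_inverse_left:
  assumes "lip_path X \<gamma>"
  shows "lip_homotopic X (concat_path (inverse_path \<gamma>) \<gamma>) (\<lambda>_. \<gamma> 1)"
  using concat_inverse_right[OF lip_path_inverse[OF assms]] by simp

lemma concat_assoc:
  assumes "lip_path X \<alpha>" "lip_path X \<beta>" "lip_path X \<gamma>" "\<alpha> 1 = \<beta> 0" "\<beta> 1 = \<gamma> 0"
  shows "lip_homotopic X (concat_path (concat_path \<alpha> \<beta>) \<gamma>) (concat_path \<alpha> (concat_path \<beta> \<gamma>))"
proof -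
  let ?F = "concat_path \<alpha> (concat_path \<beta> \<gamma>)"
  \<comment> \<open>The quarters \<open>\<alpha>\<close>, \<open>\<beta>\<close> and the half \<open>\<gamma>\<close> on the left are stretched by \<open>2\<close>, shifted, and shrunk
    by \<open>1/2\<close> respectively to give the half \<open>\<alpha>\<close> and the quarters \<open>\<beta>\<close>, \<open>\<gamma>\<close> on the right.\<close>
  define \<phi> :: "real \<Rightarrow> real" where "\<phi> = (\<lambda>t. if t \<le> 1/4 then 2 * t else if t \<le> 1/2 then t + 1/4 else (t + 1) / 2)"
  have F: "lip_path X ?F" using assms by (intro lip_path_concat) auto
  have "lip_homotopic X (?F \<circ> \<phi>) (?F \<circ> (\<lambda>t. t))"
    using F
  proof (rule lip_homotopic_reparam)
    show "lip_path unit_interval \<phi>"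
      by (rule lip_pathI[where L = 2]) (auto simp: \<phi>_def dist_real_def abs_if field_simps)
  qed (auto simp: \<phi>_def lip_path_def Lipschitz_continuous_map_id)
  then show ?thesis
  proof (rule lip_homotopic_cong)
    fix t :: real
    consider "t \<le> 1/4" | "1/4 < t" "t \<le> 1/2" | "1/2 < t" by linarith
    then show "(?F \<circ> \<phi>) t = concat_path (concat_path \<alpha> \<beta>) \<gamma> t"
    proof cases
      case 1
      then have "\<phi> t = 2 * t" "\<phi> t \<le> 1/2" "t \<le> 1/2" by (auto simp: \<phi>_def)
      then show ?thesis by (simp add: concat_path_def)
    next
      case 2
      then have "\<phi> t = t + 1/4" by (auto simp: \<phi>_def)
      with 2 have "\<not> \<phi> t \<le> 1/2" "2 * \<phi> t - 1 \<le> 1/2" "2 * (2 * \<phi> t - 1) = 2 * (2 * t) - 1" "\<not> 2 * t \<le> 1/2"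
        by auto
      with 2 show ?thesis by (simp only: concat_path_def o_def if_True if_False)
    next
      case 3
      then have "\<phi> t = (t + 1) / 2" by (auto simp: \<phi>_def)
      with 3 have "\<not> \<phi> t \<le> 1/2" "2 * \<phi> t - 1 = t" "\<not> t \<le> 1/2" by auto
      then show ?thesis by (simp only: concat_path_def o_def if_False)
    qed
  qed auto
qed

section \<open>Length of Lipschitz paths\<close>

text \<open>The length is refined to the variation over a subinterval, since the superadditivity of length
over subintervals is what bounds the length of the canonical paths in the universal path space.\<close>
definition variation_sums :: "'a metric \<Rightarrow> (real \<Rightarrow> 'a) \<Rightarrow> real \<Rightarrow> real \<Rightarrow> real set" where
  "variation_sums X \<gamma> a b =
     {\<Sum>i<n. mdist X (\<gamma> (t i)) (\<gamma> (t (Suc i))) | (t :: nat \<Rightarrow> real) n.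
            t 0 = a \<and> t n = b \<and> (\<forall>i<n. t i \<le> t (Suc i))}"

definition variation :: "'a metric \<Rightarrow> (real \<Rightarrow> 'a) \<Rightarrow> real \<Rightarrow> real \<Rightarrow> real" where
  "variation X \<gamma> a b = Sup (variation_sums X \<gamma> a b)"

lemma path_len_eq_variation: "path_len X \<gamma> = variation X \<gamma> 0 1"
  by (simp add: path_len_def variation_def variation_sums_def)

lemma variation_sumsI:
  "\<lbrakk>t 0 = a; t n = b; \<And>i. i < n \<Longrightarrow> t i \<le> t (Suc i)\<rbrakk>
    \<Longrightarrow> (\<Sum>i<n. mdist X (\<gamma> (t i)) (\<gamma> (t (Suc i)))) \<in> variation_sums X \<gamma> a b"
  unfolding variation_sums_def by blast

lemma partition_bounds:
  fixes t :: "nat \<Rightarrow> real"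
  assumes "\<And>i. i < n \<Longrightarrow> t i \<le> t (Suc i)" "i \<le> n"
  shows "t 0 \<le> t i" "t i \<le> t n"
proof -
  have "t 0 \<le> t i" if "i \<le> n" for i
    using that by (induction i) (use assms(1) in \<open>auto simp: Suc_le_eq intro: order_trans\<close>)
  then show "t 0 \<le> t i" using assms(2) by blast
  show "t i \<le> t n"
    using assms(2)
    by (induction rule: inc_induct) (use assms(1) in \<open>auto intro: order_trans\<close>)
qed

lemma variation_sums_nonempty: "a \<le> b \<Longrightarrow> variation_sums X \<gamma> a b \<noteq> {}"
  using variation_sumsI[of "\<lambda>i. if i = 0 then a else b" a 1 b X \<gamma>] by fastforce

lemma variation_sums_le:
  assumes L: "\<And>s t. \<lbrakk>a \<le> s; s \<le> t; t \<le> b\<rbrakk> \<Longrightarrow> mdist X (\<gamma> s) (\<gamma> t) \<le> L * (t - s)"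
    and v: "v \<in> variation_sums X \<gamma> a b"
  shows "v \<le> L * (b - a)"
proof -
  obtain t n where t: "v = (\<Sum>i<n. mdist X (\<gamma> (t i)) (\<gamma> (t (Suc i))))" "t 0 = a" "t n = b"
    "\<And>i. i < n \<Longrightarrow> t i \<le> t (Suc i)"
    using v unfolding variation_sums_def by blast
  have "v \<le> (\<Sum>i<n. L * (t (Suc i) - t i))"
    unfolding t(1)
  proof (rule sum_mono)
    fix i assume "i \<in> {..<n}"
    then show "mdist X (\<gamma> (t i)) (\<gamma> (t (Suc i))) \<le> L * (t (Suc i) - t i)"
      using t partition_bounds[of n t i] partition_bounds[of n t "Suc i"] by (intro L) auto
  qed
  also have "\<dots> = L * (t n - t 0)"
    by (simp add: sum_lessThan_telescope flip: sum_distrib_left)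
  finally show ?thesis by (simp add: t)
qed

lemma variation_sums_bdd_above:
  assumes "lip_path X \<gamma>" "0 \<le> a" "b \<le> 1"
  shows "bdd_above (variation_sums X \<gamma> a b)"
  using assms(1)
proof (rule lip_pathE)
  fix L assume L: "\<And>s t. \<lbrakk>s \<in> {0..1}; t \<in> {0..1}\<rbrakk> \<Longrightarrow> mdist X (\<gamma> s) (\<gamma> t) \<le> L * \<bar>s - t\<bar>"
  have "mdist X (\<gamma> s) (\<gamma> t) \<le> L * (t - s)" if "a \<le> s" "s \<le> t" "t \<le> b" for s t
    using L[of s t] that assms by auto
  from variation_sums_le[OF this] show ?thesis by (rule bdd_aboveI)
qed

lemma variation_upper:
  "\<lbrakk>lip_path X \<gamma>; 0 \<le> a; b \<le> 1; v \<in> variation_sums X \<gamma> a b\<rbrakk> \<Longrightarrow> v \<le> variation X \<gamma> a b"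
  unfolding variation_def by (intro cSup_upper variation_sums_bdd_above)

lemma variation_least:
  "\<lbrakk>a \<le> b; \<And>v. v \<in> variation_sums X \<gamma> a b \<Longrightarrow> v \<le> c\<rbrakk> \<Longrightarrow> variation X \<gamma> a b \<le> c"
  unfolding variation_def by (intro cSup_least variation_sums_nonempty)

lemma mdist_le_variation:
  assumes "lip_path X \<gamma>" "0 \<le> a" "a \<le> b" "b \<le> 1"
  shows "mdist X (\<gamma> a) (\<gamma> b) \<le> variation X \<gamma> a b"
  using variation_sumsI[of "\<lambda>i. if i = 0 then a else b" a 1 b X \<gamma>] assms
  by (intro variation_upper) auto

lemma variation_nonneg:
  "\<lbrakk>lip_path X \<gamma>; 0 \<le> a; a \<le> b; b \<le> 1\<rbrakk> \<Longrightarrow> 0 \<le> variation X \<gamma> a b"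
  by (meson mdist_le_variation mdist_nonneg order_trans)

text \<open>A partition of \<open>[a,b]\<close> followed by a partition of \<open>[b,c]\<close> is a partition of \<open>[a,c]\<close>.\<close>
lemma variation_superadditive:
  assumes \<gamma>: "lip_path X \<gamma>" and abc: "0 \<le> a" "a \<le> b" "b \<le> c" "c \<le> 1"
  shows "variation X \<gamma> a b + variation X \<gamma> b c \<le> variation X \<gamma> a c"
proof -
  have sums: "v + w \<le> variation X \<gamma> a c"
    if vw: "v \<in> variation_sums X \<gamma> a b" "w \<in> variation_sums X \<gamma> b c" for v w
  proof -
    obtain t n where t: "v = (\<Sum>i<n. mdist X (\<gamma> (t i)) (\<gamma> (t (Suc i))))" "t 0 = a" "t n = b"
      "\<And>i. i < n \<Longrightarrow> t i \<le> t (Suc i)"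
      using vw(1) unfolding variation_sums_def by blast
    obtain s m where s: "w = (\<Sum>i<m. mdist X (\<gamma> (s i)) (\<gamma> (s (Suc i))))" "s 0 = b" "s m = c"
      "\<And>i. i < m \<Longrightarrow> s i \<le> s (Suc i)"
      using vw(2) unfolding variation_sums_def by blast
    define u where "u = (\<lambda>i. if i \<le> n then t i else s (i - n))"
    have u_left: "u i = t i" if "i \<le> n" for i using that by (simp add: u_def)
    have u_right: "u (n + i) = s i" for i using t(3) s(2) by (cases i) (auto simp: u_def)
    have "(\<Sum>i<n + m. mdist X (\<gamma> (u i)) (\<gamma> (u (Suc i)))) =
        (\<Sum>i<n. mdist X (\<gamma> (u i)) (\<gamma> (u (Suc i)))) + (\<Sum>i<m. mdist X (\<gamma> (u (n + i))) (\<gamma> (u (n + Suc i))))"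
      by (induction m) auto
    also have "\<dots> = v + w"
      unfolding u_right t(1) s(1) by (simp add: u_left)
    finally have eq: "(\<Sum>i<n + m. mdist X (\<gamma> (u i)) (\<gamma> (u (Suc i)))) = v + w" .
    have "(\<Sum>i<n + m. mdist X (\<gamma> (u i)) (\<gamma> (u (Suc i)))) \<in> variation_sums X \<gamma> a c"
    proof (rule variation_sumsI)
      fix i assume i: "i < n + m"
      show "u i \<le> u (Suc i)"
      proof (cases "i < n")
        case True then show ?thesis using t(4) by (simp add: u_left)
      next
        case False
        then obtain j where "i = n + j" using le_Suc_ex by (metis not_less)
        then show ?thesis using i s(4)[of j] u_right[of j] u_right[of "Suc j"] by simp
      qed
    qed (use t s u_left[of 0] u_right[of m] in auto)
    then show ?thesis using variation_upper[OF \<gamma>] abc eq by auto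
  qed
  have "variation X \<gamma> b c \<le> variation X \<gamma> a c - v" if "v \<in> variation_sums X \<gamma> a b" for v
    using sums[OF that] abc by (intro variation_least) (auto simp: algebra_simps)
  then have "variation X \<gamma> a b \<le> variation X \<gamma> a c - variation X \<gamma> b c"
    using abc by (intro variation_least) (force simp: algebra_simps)+
  then show ?thesis by simp
qed

lemma sum_variation_le:
  assumes \<gamma>: "lip_path X \<gamma>" and t: "0 \<le> t 0" "t n \<le> 1" "\<And>i. i < n \<Longrightarrow> t i \<le> t (Suc i)"
  shows "(\<Sum>i<n. variation X \<gamma> (t i) (t (Suc i))) \<le> variation X \<gamma> (t 0) (t n)"
proof -
  have "(\<Sum>i<k. variation X \<gamma> (t i) (t (Suc i))) \<le> variation X \<gamma> (t 0) (t k)" if "k \<le> n" for k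
    using that
  proof (induction k)
    case 0
    then show ?case using variation_nonneg[OF \<gamma>, of "t 0" "t 0"] t partition_bounds[of n t 0] by auto
  next
    case (Suc k)
    have "variation X \<gamma> (t 0) (t k) + variation X \<gamma> (t k) (t (Suc k)) \<le> variation X \<gamma> (t 0) (t (Suc k))"
      using Suc.prems t partition_bounds[of n t k] partition_bounds[of n t "Suc k"]
      by (intro variation_superadditive[OF \<gamma>]) auto
    with Suc show ?case by simp
  qed
  then show ?thesis by simp
qed

definition path_segment :: "(real \<Rightarrow> 'a) \<Rightarrow> real \<Rightarrow> real \<Rightarrow> real \<Rightarrow> 'a" where
  "path_segment \<gamma> a b = (\<lambda>u. \<gamma> (a + u * (b - a)))"

lemma path_segment_ends [simp]: "path_segment \<gamma> a b 0 = \<gamma> a" "path_segment \<gamma> a b 1 = \<gamma> b"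
  by (auto simp: path_segment_def)

lemma lip_path_affine:
  assumes "a \<in> {0..1}" "b \<in> {0..1}"
  shows "lip_path unit_interval (\<lambda>u. a + u * (b - a))"
proof (rule lip_pathI[where L = 1])
  fix s t :: real assume "s \<in> {0..1}" "t \<in> {0..1}" "s \<le> t"
  moreover have "\<bar>b - a\<bar> \<le> 1" using assms by auto
  moreover have "(a + s * (b - a)) - (a + t * (b - a)) = (s - t) * (b - a)"
    by (simp add: algebra_simps)
  ultimately show "mdist unit_interval (a + s * (b - a)) (a + t * (b - a)) \<le> 1 * (t - s)"
    using mult_left_mono[of "\<bar>b - a\<bar>" 1 "\<bar>s - t\<bar>"]
    by (simp add: dist_real_def abs_mult)
next
  fix t :: real assume "t \<in> {0..1}"
  then have "a + t * (b - a) = (1 - t) * a + t * b" "0 \<le> t" "t \<le> 1" by (auto simp: algebra_simps)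
  then show "a + t * (b - a) \<in> mspace unit_interval"
    using assms convex_bound_le[of a 1 b "1 - t" t] by auto
qed

lemma lip_path_segment:
  "\<lbrakk>lip_path X \<gamma>; a \<in> {0..1}; b \<in> {0..1}\<rbrakk> \<Longrightarrow> lip_path X (path_segment \<gamma> a b)"
  using lip_path_reparam[OF _ lip_path_affine] by (auto simp: path_segment_def o_def)

lemma path_len_segment_le:
  assumes \<gamma>: "lip_path X \<gamma>" and ab: "0 \<le> a" "a \<le> b" "b \<le> 1"
  shows "path_len X (path_segment \<gamma> a b) \<le> variation X \<gamma> a b"
  unfolding path_len_eq_variation
proof (rule variation_least)
  fix v assume "v \<in> variation_sums X (path_segment \<gamma> a b) 0 1"
  then obtain t n where t: "v = (\<Sum>i<n. mdist X (path_segment \<gamma> a b (t i)) (path_segment \<gamma> a b (t (Suc i))))"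
    "t 0 = 0" "t n = 1" "\<And>i. i < n \<Longrightarrow> t i \<le> t (Suc i)"
    unfolding variation_sums_def by blast
  have "v \<in> variation_sums X \<gamma> a b"
    unfolding t(1) path_segment_def
    by (rule variation_sumsI) (use t ab in \<open>auto intro!: mult_right_mono\<close>)
  then show "v \<le> variation X \<gamma> a b" using variation_upper[OF \<gamma>] ab by simp
qed simp

lemma variation_le:
  assumes "\<And>s t. \<lbrakk>a \<le> s; s \<le> t; t \<le> b\<rbrakk> \<Longrightarrow> mdist X (\<gamma> s) (\<gamma> t) \<le> L * (t - s)" "a \<le> b"
  shows "variation X \<gamma> a b \<le> L * (b - a)"
  using variation_sums_le[OF assms(1)] by (intro variation_least assms) auto

lemma path_len_nonneg: "lip_path X \<gamma> \<Longrightarrow> 0 \<le> path_len X \<gamma>"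
  by (simp add: path_len_eq_variation variation_nonneg)

lemma mdist_le_path_len: "lip_path X \<gamma> \<Longrightarrow> mdist X (\<gamma> 0) (\<gamma> 1) \<le> path_len X \<gamma>"
  by (simp add: path_len_eq_variation mdist_le_variation)

lemma path_len_compose_le:
  assumes \<gamma>: "lip_path X \<gamma>" and L: "0 \<le> L"
    and f: "\<And>x y. \<lbrakk>x \<in> mspace X; y \<in> mspace X\<rbrakk> \<Longrightarrow> mdist Y (f x) (f y) \<le> L * mdist X x y"
  shows "path_len Y (f \<circ> \<gamma>) \<le> L * path_len X \<gamma>"
  unfolding path_len_eq_variation
proof (rule variation_least)
  fix v assume "v \<in> variation_sums Y (f \<circ> \<gamma>) 0 1"
  then obtain t n where t: "v = (\<Sum>i<n. mdist Y ((f \<circ> \<gamma>) (t i)) ((f \<circ> \<gamma>) (t (Suc i))))"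
    "t 0 = 0" "t n = 1" "\<And>i. i < n \<Longrightarrow> t i \<le> t (Suc i)"
    unfolding variation_sums_def by blast
  have t01: "t i \<in> {0..1}" if "i \<le> n" for i
    using partition_bounds[of n t i] that t by auto
  have "v \<le> (\<Sum>i<n. L * mdist X (\<gamma> (t i)) (\<gamma> (t (Suc i))))"
    unfolding t(1) using t01 lip_path_in_mspace[OF \<gamma>] by (auto intro!: sum_mono f)
  also have "\<dots> = L * (\<Sum>i<n. mdist X (\<gamma> (t i)) (\<gamma> (t (Suc i))))"
    by (simp add: sum_distrib_left)
  also have "\<dots> \<le> L * variation X \<gamma> 0 1"
    using L by (intro mult_left_mono variation_upper[OF \<gamma>] variation_sumsI) (use t in auto)
  finally show "v \<le> L * variation X \<gamma> 0 1" .
qed simp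

text \<open>For a Lipschitz map the infimum in \<^const>\<open>lip_const\<close> is attained, so it is itself a Lipschitz constant.\<close>
lemma lip_const_bound:
  assumes "Lipschitz_continuous_map X Y f"
  shows "0 \<le> lip_const X Y f"
    and "\<And>x y. \<lbrakk>x \<in> mspace X; y \<in> mspace X\<rbrakk> \<Longrightarrow> mdist Y (f x) (f y) \<le> lip_const X Y f * mdist X x y"
proof -
  define S where "S = {L. 0 \<le> L \<and> (\<forall>x\<in>mspace X. \<forall>y\<in>mspace X. mdist Y (f x) (f y) \<le> L * mdist X x y)}"
  have ne: "S \<noteq> {}"
    using assms unfolding Lipschitz_continuous_map_pos S_def by (auto intro: less_imp_le)
  show "0 \<le> lip_const X Y f"
    unfolding lip_const_def S_def[symmetric] using ne by (rule cInf_greatest) (auto simp: S_def)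
  fix x y assume xy: "x \<in> mspace X" "y \<in> mspace X"
  show "mdist Y (f x) (f y) \<le> lip_const X Y f * mdist X x y"
  proof (cases "mdist X x y = 0")
    case True
    moreover obtain L where "mdist Y (f x) (f y) \<le> L * mdist X x y"
      using ne xy by (auto simp: S_def)
    ultimately show ?thesis by (simp only: mult_zero_right)
  next
    case False
    then have pos: "0 < mdist X x y" using mdist_nonneg[of X x y] by linarith
    have "mdist Y (f x) (f y) / mdist X x y \<le> Inf S"
      using ne pos xy by (intro cInf_greatest) (auto simp: S_def divide_le_eq)
    then show ?thesis using pos by (simp add: lip_const_def S_def divide_le_eq)
  qed
qed

lemma lip_const_le:
  assumes "0 \<le> L" "\<And>x y. \<lbrakk>x \<in> mspace X; y \<in> mspace X\<rbrakk> \<Longrightarrow> mdist Y (f x) (f y) \<le> L * mdist X x y"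
  shows "lip_const X Y f \<le> L"
  unfolding lip_const_def using assms by (intro cInf_lower bdd_belowI[of _ 0]) auto

section \<open>Homotopy classes and trivial induced maps\<close>

lemma lip_class_eq_iff:
  "lip_path X \<gamma> \<Longrightarrow> lip_class X \<gamma> = lip_class X \<delta> \<longleftrightarrow> lip_homotopic X \<gamma> \<delta>"
  unfolding lip_class_def set_eq_iff mem_Collect_eq
  using lip_homotopic_refl lip_homotopic_sym lip_homotopic_trans by blast

lemma lip_class_eqI: "lip_homotopic X \<gamma> \<delta> \<Longrightarrow> lip_class X \<gamma> = lip_class X \<delta>"
  using lip_class_eq_iff lip_homotopicD(1) by blast

text \<open>The triviality of \<open>f\<^sub>#\<close>, expressed on representatives. In this form it passes directly to isometric
copies of the domain.\<close>
definition null_on_loops :: "'a metric \<Rightarrow> 'a \<Rightarrow> 'b metric \<Rightarrow> ('a \<Rightarrow> 'b) \<Rightarrow> bool" where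
  "null_on_loops X x0 Y f \<longleftrightarrow>
     (\<forall>\<alpha>. lip_path X \<alpha> \<and> \<alpha> 0 = x0 \<and> \<alpha> 1 = x0 \<longrightarrow> lip_homotopic Y (f \<circ> \<alpha>) (\<lambda>_. f x0))"

lemma induced_map_lip_class:
  assumes "lip_path X \<alpha>" "Lipschitz_continuous_map X Y f"
  shows "induced_map Y f (lip_class X \<alpha>) = lip_class Y (f \<circ> \<alpha>)"
proof -
  have "lip_class Y (f \<circ> \<beta>) = lip_class Y (f \<circ> \<alpha>)" if "\<beta> \<in> lip_class X \<alpha>" for \<beta>
  proof -
    have "lip_homotopic Y (f \<circ> \<alpha>) (f \<circ> \<beta>)"
      using that lip_homotopic_compose[OF _ assms(2)] by (simp add: lip_class_def)
    then show ?thesis by (rule lip_class_eqI[symmetric])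
  qed
  moreover have "\<alpha> \<in> lip_class X \<alpha>"
    using lip_homotopic_refl[OF assms(1)] by (simp add: lip_class_def)
  ultimately show ?thesis unfolding induced_map_def by blast
qed

lemma lip_class_mult:
  assumes "lip_path X \<alpha>" "lip_path X \<beta>" "\<alpha> 1 = \<beta> 0"
  shows "(\<Union>\<alpha>'\<in>lip_class X \<alpha>. \<Union>\<beta>'\<in>lip_class X \<beta>. lip_class X (concat_path \<alpha>' \<beta>')) = lip_class X (concat_path \<alpha> \<beta>)"
proof -
  have "lip_class X (concat_path \<alpha>' \<beta>') = lip_class X (concat_path \<alpha> \<beta>)"
    if "\<alpha>' \<in> lip_class X \<alpha>" "\<beta>' \<in> lip_class X \<beta>" for \<alpha>' \<beta>'
    using that assms(3)
    by (intro lip_class_eqI[symmetric] lip_homotopic_concat) (auto simp: lip_class_def)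
  moreover have "\<alpha> \<in> lip_class X \<alpha>" "\<beta> \<in> lip_class X \<beta>"
    using assms lip_homotopic_refl by (auto simp: lip_class_def)
  ultimately show ?thesis by blast
qed

text \<open>All classes go to the class of the constant loop, and that class is idempotent; hence the induced
map is multiplicative.\<close>
lemma induces_trivial_if_null_on_loops:
  assumes f: "based_lip_map X x0 Y y0 f" and null: "null_on_loops X x0 Y f"
  shows "induces_trivial X x0 Y y0 f"
proof -
  have lf: "Lipschitz_continuous_map X Y f" and y0: "f x0 = y0" "y0 \<in> mspace Y" and x0: "x0 \<in> mspace X"
    using f by (auto simp: based_lip_map_def)
  have trivial: "induced_map Y f (lip_class X \<alpha>) = lip_class Y (\<lambda>_. y0)"
    if "lip_path X \<alpha>" "\<alpha> 0 = x0" "\<alpha> 1 = x0" for \<alpha>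
  proof -
    have "lip_homotopic Y (f \<circ> \<alpha>) (\<lambda>_. y0)" using that null y0 by (simp add: null_on_loops_def)
    then show ?thesis by (simp add: induced_map_lip_class[OF that(1) lf] lip_class_eqI)
  qed
  have one: "lip_path Y (\<lambda>_. y0)" using y0 by (simp add: lip_path_const)
  have one_one: "(\<Union>\<alpha>\<in>lip_class Y (\<lambda>_. y0). \<Union>\<beta>\<in>lip_class Y (\<lambda>_. y0). lip_class Y (concat_path \<alpha> \<beta>))
      = lip_class Y (\<lambda>_. y0)"
    using lip_class_mult[OF one one] by (simp add: concat_path_def)
  show ?thesis
    unfolding induces_trivial_def trivial_homomorphism_def
  proof (intro conjI ballI homI)
    fix A assume A: "A \<in> carrier (lip_pi1 X x0)"
    then show "induced_map Y f A = \<one>\<^bsub>lip_pi1 Y y0\<^esub>"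
      using trivial by (auto simp: lip_pi1_def)
    then show "induced_map Y f A \<in> carrier (lip_pi1 Y y0)"
      using one by (auto simp: lip_pi1_def)
    fix B assume B: "B \<in> carrier (lip_pi1 X x0)"
    obtain \<alpha> \<beta> where \<alpha>: "A = lip_class X \<alpha>" "lip_path X \<alpha>" "\<alpha> 0 = x0" "\<alpha> 1 = x0"
      and \<beta>: "B = lip_class X \<beta>" "lip_path X \<beta>" "\<beta> 0 = x0" "\<beta> 1 = x0"
      using A B by (auto simp: lip_pi1_def)
    have "A \<otimes>\<^bsub>lip_pi1 X x0\<^esub> B = lip_class X (concat_path \<alpha> \<beta>)"
      using lip_class_mult[of X \<alpha> \<beta>] \<alpha> \<beta> by (simp add: lip_pi1_def)
    then show "induced_map Y f (A \<otimes>\<^bsub>lip_pi1 X x0\<^esub> B) =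
        induced_map Y f A \<otimes>\<^bsub>lip_pi1 Y y0\<^esub> induced_map Y f B"
      using trivial[of "concat_path \<alpha> \<beta>"] trivial[of \<alpha>] trivial[of \<beta>] \<alpha> \<beta> lip_path_concat[of X \<alpha> \<beta>] one_one
      by (simp add: lip_pi1_def)
  qed
qed

text \<open>The loop \<open>\<alpha> * \<beta>\<close>, with \<open>\<beta>\<close> reversed, is null-homotopic; appending \<open>\<beta>\<close> to it and cancelling gives \<open>\<alpha>\<close>
on one side and \<open>\<beta>\<close> on the other.\<close>
lemma lip_simply_connected_homotopic:
  assumes X: "lip_simply_connected X" and \<alpha>: "lip_path X \<alpha>" and \<beta>: "lip_path X \<beta>"
    and ends: "\<alpha> 0 = \<beta> 0" "\<alpha> 1 = \<beta> 1"
  shows "lip_homotopic X \<alpha> \<beta>"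
proof -
  define \<eta> where "\<eta> = concat_path \<alpha> (inverse_path \<beta>)"
  have \<eta>: "lip_path X \<eta>" "\<eta> 0 = \<alpha> 0" "\<eta> 1 = \<alpha> 0"
    using \<alpha> \<beta> ends by (auto simp: \<eta>_def intro!: lip_path_concat lip_path_inverse)
  have x: "\<alpha> 0 \<in> mspace X" using lip_path_in_mspace[OF \<alpha>] by simp
  have "lip_class X \<eta> \<in> carrier (lip_pi1 X (\<alpha> 0))"
    using \<eta> by (auto simp: lip_pi1_def)
  then have "lip_class X \<eta> = lip_class X (\<lambda>_. \<alpha> 0)"
    using X x by (auto simp: lip_simply_connected_def trivial_group_def lip_pi1_def)
  then have null: "lip_homotopic X \<eta> (\<lambda>_. \<beta> 0)"
    using \<eta> ends by (simp add: lip_class_eq_iff)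
  have "lip_homotopic X \<alpha> (concat_path \<alpha> (\<lambda>_. \<beta> 1))"
    using concat_const_right[OF \<alpha>] ends by (simp add: lip_homotopic_sym)
  also have "lip_homotopic X (concat_path \<alpha> (\<lambda>_. \<beta> 1)) (concat_path \<alpha> (concat_path (inverse_path \<beta>) \<beta>))"
    using ends \<alpha> \<beta> by (intro lip_homotopic_concat lip_homotopic_refl lip_homotopic_sym[OF concat_inverse_left]) auto
  also have "lip_homotopic X (concat_path \<alpha> (concat_path (inverse_path \<beta>) \<beta>)) (concat_path \<eta> \<beta>)"
    unfolding \<eta>_def using ends \<alpha> \<beta>
    by (intro lip_homotopic_sym[OF concat_assoc] lip_path_inverse) auto
  also have "lip_homotopic X (concat_path \<eta> \<beta>) (concat_path (\<lambda>_. \<beta> 0) \<beta>)"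
    using null \<eta> ends \<beta> by (intro lip_homotopic_concat lip_homotopic_refl) auto
  also have "lip_homotopic X (concat_path (\<lambda>_. \<beta> 0) \<beta>) \<beta>"
    using \<beta> by (intro concat_const_left) auto
  finally show ?thesis .
qed

section \<open>Lifting from test spaces of another type\<close>

text \<open>The lifting properties only speak about test spaces whose points lie in one fixed type. An
injection of the points of \<open>X\<close> into that type carries the metric of \<open>X\<close> over, and all notions in the
lifting properties are invariant under the resulting isometry. So the properties hold for every
\<open>X\<close> that admits such an injection.\<close>
definition metric_copy :: "('a \<Rightarrow> 'b) \<Rightarrow> 'a metric \<Rightarrow> 'b metric" where
  "metric_copy i X = metric (i ` mspace X,
     \<lambda>a b. mdist X (inv_into (mspace X) i a) (inv_into (mspace X) i b))"

context
  fixes i :: "'a \<Rightarrow> 'x" and X :: "'a metric"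
  assumes inj: "inj_on i (mspace X)"
begin

lemma Metric_space_copy:
  "Metric_space (i ` mspace X) (\<lambda>a b. mdist X (inv_into (mspace X) i a) (inv_into (mspace X) i b))"
  by unfold_locales
    (use inj in \<open>auto simp: mdist_commute inv_into_f_f inj_on_eq_iff intro: mdist_triangle\<close>)

lemma mspace_copy: "mspace (metric_copy i X) = i ` mspace X"
  unfolding metric_copy_def by (rule Metric_space.mspace_metric[OF Metric_space_copy])

lemma mdist_copy: "\<lbrakk>x \<in> mspace X; y \<in> mspace X\<rbrakk> \<Longrightarrow> mdist (metric_copy i X) (i x) (i y) = mdist X x y"
  unfolding metric_copy_def by (simp add: Metric_space.mdist_metric[OF Metric_space_copy] inv_into_f_f[OF inj])

lemma Lipschitz_copy: "Lipschitz_continuous_map X (metric_copy i X) i"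
  by (rule Lipschitz_continuous_mapI[where L = 1]) (auto simp: mspace_copy mdist_copy)

lemma Lipschitz_uncopy: "Lipschitz_continuous_map (metric_copy i X) X (inv_into (mspace X) i)"
  by (rule Lipschitz_continuous_mapI[where L = 1]) (auto simp: mspace_copy mdist_copy inv_into_f_f[OF inj])

lemma quasi_convex_with_copy:
  assumes "quasi_convex_with C X"
  shows "quasi_convex_with C (metric_copy i X)"
  unfolding quasi_convex_with_def
proof (intro ballI)
  fix a b assume "a \<in> mspace (metric_copy i X)" "b \<in> mspace (metric_copy i X)"
  then obtain x y where xy: "a = i x" "b = i y" "x \<in> mspace X" "y \<in> mspace X"
    by (auto simp: mspace_copy)
  then obtain \<gamma> where \<gamma>: "lip_path X \<gamma>" "\<gamma> 0 = x" "\<gamma> 1 = y" "path_len X \<gamma> \<le> C * mdist X x y"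
    using assms unfolding quasi_convex_with_def by blast
  have "path_len (metric_copy i X) (i \<circ> \<gamma>) \<le> 1 * path_len X \<gamma>"
    using \<gamma>(1) by (rule path_len_compose_le) (auto simp: mdist_copy)
  then show "\<exists>\<gamma>. lip_path (metric_copy i X) \<gamma> \<and> \<gamma> 0 = a \<and> \<gamma> 1 = b \<and>
      path_len (metric_copy i X) \<gamma> \<le> C * mdist (metric_copy i X) a b"
    using \<gamma> xy lip_path_compose[OF \<gamma>(1) Lipschitz_copy]
    by (intro exI[of _ "i \<circ> \<gamma>"]) (auto simp: mdist_copy)
qed

lemma based_lip_map_copy:
  "based_lip_map X x0 Y y0 f \<Longrightarrow> based_lip_map (metric_copy i X) (i x0) Y y0 (f \<circ> inv_into (mspace X) i)"
  unfolding based_lip_map_def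
  by (auto simp: mspace_copy inv_into_f_f[OF inj] intro: Lipschitz_continuous_map_compose[OF Lipschitz_uncopy])

lemma null_on_loops_copy:
  assumes "null_on_loops X x0 Y f" "x0 \<in> mspace X"
  shows "null_on_loops (metric_copy i X) (i x0) Y (f \<circ> inv_into (mspace X) i)"
  unfolding null_on_loops_def
proof (intro allI impI)
  fix \<alpha> assume "lip_path (metric_copy i X) \<alpha> \<and> \<alpha> 0 = i x0 \<and> \<alpha> 1 = i x0"
  then have "lip_path X (inv_into (mspace X) i \<circ> \<alpha>)" "(inv_into (mspace X) i \<circ> \<alpha>) 0 = x0"
    "(inv_into (mspace X) i \<circ> \<alpha>) 1 = x0"
    using lip_path_compose[OF _ Lipschitz_uncopy] assms(2) by (auto simp: inv_into_f_f[OF inj])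
  then show "lip_homotopic Y (f \<circ> inv_into (mspace X) i \<circ> \<alpha>) (\<lambda>_. (f \<circ> inv_into (mspace X) i) (i x0))"
    using assms by (simp add: null_on_loops_def comp_assoc inv_into_f_f[OF inj])
qed

lemma induces_trivial_copy:
  assumes "based_lip_map X x0 Y y0 f" "null_on_loops X x0 Y f"
  shows "induces_trivial (metric_copy i X) (i x0) Y y0 (f \<circ> inv_into (mspace X) i)"
  using assms by (intro induces_trivial_if_null_on_loops based_lip_map_copy null_on_loops_copy)
    (auto simp: based_lip_map_def)

lemma is_lift_copy:
  "is_lift X x0 E e0 r f g \<Longrightarrow>
    is_lift (metric_copy i X) (i x0) E e0 r (f \<circ> inv_into (mspace X) i) (g \<circ> inv_into (mspace X) i)"
  unfolding is_lift_def using based_lip_map_copy[of x0 E e0 g]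
  by (auto simp: mspace_copy inv_into_f_f[OF inj])

lemma lip_const_copy:
  "lip_const (metric_copy i X) Y (f \<circ> inv_into (mspace X) i) = lip_const X Y f"
  unfolding lip_const_def by (simp add: mspace_copy mdist_copy inv_into_f_f[OF inj])

lemma lift_exists_copy:
  assumes "unique_lifting_property TYPE('x) E e0 M p0 r"
    and "quasi_convex X" "based_lip_map X x0 M p0 f" "null_on_loops X x0 M f"
  shows "\<exists>g. is_lift X x0 E e0 r f g"
proof -
  have "quasi_convex (metric_copy i X)"
    using assms(2) quasi_convex_with_copy by (auto simp: quasi_convex_def)
  then obtain g where g: "is_lift (metric_copy i X) (i x0) E e0 r (f \<circ> inv_into (mspace X) i) g"
    using assms(1) based_lip_map_copy[OF assms(3)] induces_trivial_copy[OF assms(3,4)]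
    unfolding unique_lifting_property_def by blast
  have "Lipschitz_continuous_map X E (g \<circ> i)"
    using g by (intro Lipschitz_continuous_map_compose[OF Lipschitz_copy])
      (auto simp: is_lift_def based_lip_map_def)
  then have "is_lift X x0 E e0 r f (g \<circ> i)"
    using g assms(3) by (auto simp: is_lift_def based_lip_map_def mspace_copy inv_into_f_f[OF inj])
  then show ?thesis by blast
qed

lemma lift_unique_copy:
  assumes "unique_lifting_property TYPE('x) E e0 M p0 r"
    and "quasi_convex X" "based_lip_map X x0 M p0 f" "null_on_loops X x0 M f"
    and lifts: "is_lift X x0 E e0 r f g" "is_lift X x0 E e0 r f h" and x: "x \<in> mspace X"
  shows "g x = h x"
proof -
  have "quasi_convex (metric_copy i X)"
    using assms(2) quasi_convex_with_copy by (auto simp: quasi_convex_def)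
  then have "(g \<circ> inv_into (mspace X) i) a = (h \<circ> inv_into (mspace X) i) a" if "a \<in> mspace (metric_copy i X)" for a
    using assms(1) based_lip_map_copy[OF assms(3)] induces_trivial_copy[OF assms(3,4)]
      lifts[THEN is_lift_copy] that
    unfolding unique_lifting_property_def by blast
  from this[of "i x"] show ?thesis
    using x by (simp add: mspace_copy inv_into_f_f[OF inj])
qed

lemma lift_preserves_Lip_copy:
  assumes "lifts_preserve_Lip TYPE('x) E e0 M p0 r"
    and "length_space X" "based_lip_map X x0 M p0 f" "null_on_loops X x0 M f"
    and lift: "is_lift X x0 E e0 r f g"
  shows "lip_const X E g = lip_const X M f"
proof -
  have "length_space (metric_copy i X)"
    using assms(2) quasi_convex_with_copy by (auto simp: length_space_def)
  then have "lip_const (metric_copy i X) E (g \<circ> inv_into (mspace X) i) =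
      lip_const (metric_copy i X) M (f \<circ> inv_into (mspace X) i)"
    using assms(1) based_lip_map_copy[OF assms(3)] induces_trivial_copy[OF assms(3,4)] is_lift_copy[OF lift]
    unfolding lifts_preserve_Lip_def by blast
  then show ?thesis by (simp add: lip_const_copy)
qed

end

section \<open>The metric of the universal path space\<close>

lemma concat_segments:
  assumes \<gamma>: "lip_path X \<gamma>" and abc: "a \<in> {0..1}" "b \<in> {0..1}" "c \<in> {0..1}"
  shows "lip_homotopic X (concat_path (path_segment \<gamma> a b) (path_segment \<gamma> b c)) (path_segment \<gamma> a c)"
proof -
  have "lip_homotopic X (\<gamma> \<circ> concat_path (\<lambda>u. a + u * (b - a)) (\<lambda>u. b + u * (c - b))) (\<gamma> \<circ> (\<lambda>u. a + u * (c - a)))"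
    using abc by (intro lip_homotopic_reparam[OF \<gamma>] lip_path_concat lip_path_affine) auto
  then show ?thesis
    by (rule lip_homotopic_cong) (auto simp: concat_path_def path_segment_def)
qed

lemma concat_cancel:
  assumes "lip_path X \<gamma>" "lip_path X \<delta>" "\<gamma> 0 = \<delta> 0"
  shows "lip_homotopic X (concat_path \<gamma> (concat_path (inverse_path \<gamma>) \<delta>)) \<delta>"
proof -
  have "lip_homotopic X (concat_path \<gamma> (concat_path (inverse_path \<gamma>) \<delta>)) (concat_path (concat_path \<gamma> (inverse_path \<gamma>)) \<delta>)"
    using assms by (intro lip_homotopic_sym[OF concat_assoc] lip_path_inverse) auto
  also have "lip_homotopic X \<dots> (concat_path (\<lambda>_. \<delta> 0) \<delta>)"
    using assms concat_inverse_right[OF assms(1)] by (intro lip_homotopic_concat lip_homotopic_refl) auto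
  also have "lip_homotopic X \<dots> \<delta>"
    using assms by (intro concat_const_left) auto
  finally show ?thesis .
qed

text \<open>The paths \<open>\<beta>\<close> over which the infimum in the lifted metric is taken, in the equivalent form
\<open>\<gamma>1 * \<beta> \<simeq> \<gamma>2\<close>, which avoids inverse paths and suits the truncations of a path.\<close>
definition connecting_paths :: "'m metric \<Rightarrow> (real \<Rightarrow> 'm) \<Rightarrow> (real \<Rightarrow> 'm) \<Rightarrow> (real \<Rightarrow> 'm) set" where
  "connecting_paths M \<gamma>1 \<gamma>2 = {\<beta>. lip_path M \<beta> \<and> \<gamma>1 1 = \<beta> 0 \<and> lip_homotopic M (concat_path \<gamma>1 \<beta>) \<gamma>2}"

lemma connecting_paths_nonempty:
  "\<lbrakk>lip_path M \<gamma>1; lip_path M \<gamma>2; \<gamma>1 0 = \<gamma>2 0\<rbrakk> \<Longrightarrow> connecting_paths M \<gamma>1 \<gamma>2 \<noteq> {}"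
  using concat_cancel[of M \<gamma>1 \<gamma>2] lip_path_concat[OF lip_path_inverse, of M \<gamma>1 \<gamma>2]
  by (auto simp: connecting_paths_def intro!: exI[of _ "concat_path (inverse_path \<gamma>1) \<gamma>2"])

lemma in_path_space: "\<lbrakk>lip_path M \<gamma>; \<gamma> 0 = p0\<rbrakk> \<Longrightarrow> lip_class M \<gamma> \<in> path_space M p0"
  by (auto simp: path_space_def)

lemma path_spaceE:
  assumes "A \<in> path_space M p0"
  obtains \<gamma> where "A = lip_class M \<gamma>" "lip_path M \<gamma>" "\<gamma> 0 = p0"
  using assms by (auto simp: path_space_def)

text \<open>The condition \<open>\<beta> \<simeq> inverse \<gamma>1 * \<gamma>2\<close> turns into \<open>\<gamma>1 * \<beta> \<simeq> \<gamma>2\<close> by cancellation on either side, and it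
does not depend on the representatives of the two classes.\<close>
lemma lifted_dist_class:
  assumes \<gamma>: "lip_path M \<gamma>1" "\<gamma>1 0 = p0" "lip_path M \<gamma>2" "\<gamma>2 0 = p0"
  shows "lifted_dist M p0 (lip_class M \<gamma>1) (lip_class M \<gamma>2) = Inf (path_len M ` connecting_paths M \<gamma>1 \<gamma>2)"
proof -
  have "{path_len M \<beta> | \<beta> \<gamma>1' \<gamma>2'. \<gamma>1' \<in> lip_class M \<gamma>1 \<and> \<gamma>2' \<in> lip_class M \<gamma>2 \<and>
      lip_homotopic M \<beta> (concat_path (inverse_path \<gamma>1') \<gamma>2')} = path_len M ` connecting_paths M \<gamma>1 \<gamma>2"
    (is "?S = ?T")
  proof (intro equalityI subsetI)
    fix l assume "l \<in> ?S"
    then obtain \<beta> \<gamma>1' \<gamma>2' where l: "l = path_len M \<beta>" and g1: "lip_homotopic M \<gamma>1 \<gamma>1'"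
      and g2: "lip_homotopic M \<gamma>2 \<gamma>2'" and b: "lip_homotopic M \<beta> (concat_path (inverse_path \<gamma>1') \<gamma>2')"
      by (auto simp: lip_class_def)
    note D = lip_homotopicD[OF g1] lip_homotopicD[OF g2] lip_homotopicD[OF b]
    have "lip_homotopic M (concat_path \<gamma>1 \<beta>) (concat_path \<gamma>1' (concat_path (inverse_path \<gamma>1') \<gamma>2'))"
      using g1 b D by (intro lip_homotopic_concat) auto
    also have "lip_homotopic M \<dots> \<gamma>2'"
      using D \<gamma> by (intro concat_cancel) auto
    also have "lip_homotopic M \<gamma>2' \<gamma>2" using g2 by (rule lip_homotopic_sym)
    finally show "l \<in> ?T"
      using l D by (auto simp: connecting_paths_def)
  next
    fix l assume "l \<in> ?T"
    then obtain \<beta> where l: "l = path_len M \<beta>" and b: "lip_path M \<beta>" "\<gamma>1 1 = \<beta> 0"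
      "lip_homotopic M (concat_path \<gamma>1 \<beta>) \<gamma>2"
      by (auto simp: connecting_paths_def)
    have "lip_homotopic M \<beta> (concat_path (inverse_path \<gamma>1) (concat_path \<gamma>1 \<beta>))"
      using concat_cancel[of M "inverse_path \<gamma>1" \<beta>] b \<gamma> by (auto intro: lip_homotopic_sym lip_path_inverse)
    also have "lip_homotopic M \<dots> (concat_path (inverse_path \<gamma>1) \<gamma>2)"
      using b \<gamma> by (intro lip_homotopic_concat lip_homotopic_refl lip_path_inverse) auto
    finally show "l \<in> ?S"
      using l \<gamma> lip_homotopic_refl by (force simp: lip_class_def)
  qed
  then show ?thesis
    using \<gamma> by (simp add: lifted_dist_def in_path_space)
qed

lemma lifted_dist_le:
  assumes "lip_path M \<gamma>1" "\<gamma>1 0 = p0" "lip_path M \<gamma>2" "\<gamma>2 0 = p0" "\<beta> \<in> connecting_paths M \<gamma>1 \<gamma>2"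
  shows "lifted_dist M p0 (lip_class M \<gamma>1) (lip_class M \<gamma>2) \<le> path_len M \<beta>"
  unfolding lifted_dist_class[OF assms(1-4)]
  by (intro cInf_lower bdd_belowI[of _ 0] imageI assms)
    (auto simp: connecting_paths_def path_len_nonneg)

lemma lifted_dist_approx:
  assumes "lip_path M \<gamma>1" "\<gamma>1 0 = p0" "lip_path M \<gamma>2" "\<gamma>2 0 = p0"
    and "lifted_dist M p0 (lip_class M \<gamma>1) (lip_class M \<gamma>2) < c"
  obtains \<beta> where "\<beta> \<in> connecting_paths M \<gamma>1 \<gamma>2" "path_len M \<beta> < c"
  using assms(5) cInf_lessD[of "path_len M ` connecting_paths M \<gamma>1 \<gamma>2" c]
    connecting_paths_nonempty[OF assms(1,3)] assms(2,4)
  unfolding lifted_dist_class[OF assms(1-4)] by auto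

lemma endpoint_proj_class:
  assumes "lip_path M \<gamma>"
  shows "endpoint_proj (lip_class M \<gamma>) = \<gamma> 1"
  unfolding endpoint_proj_def
proof (rule the_equality)
  show "\<exists>\<delta>\<in>lip_class M \<gamma>. \<gamma> 1 = \<delta> 1"
    using lip_homotopic_refl[OF assms] by (auto simp: lip_class_def)
qed (auto simp: lip_class_def dest: lip_homotopicD)

text \<open>Every connecting path joins the two endpoints, so its length is at least their distance: endpoint
projection is 1-Lipschitz.\<close>
lemma mdist_endpoint_le:
  assumes "A \<in> path_space M p0" "B \<in> path_space M p0"
  shows "mdist M (endpoint_proj A) (endpoint_proj B) \<le> lifted_dist M p0 A B"
proof -
  obtain \<gamma>1 where 1: "A = lip_class M \<gamma>1" "lip_path M \<gamma>1" "\<gamma>1 0 = p0" using path_spaceE[OF assms(1)] .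
  obtain \<gamma>2 where 2: "B = lip_class M \<gamma>2" "lip_path M \<gamma>2" "\<gamma>2 0 = p0" using path_spaceE[OF assms(2)] .
  have "mdist M (\<gamma>1 1) (\<gamma>2 1) \<le> path_len M \<beta>" if "\<beta> \<in> connecting_paths M \<gamma>1 \<gamma>2" for \<beta>
  proof -
    have "\<gamma>1 1 = \<beta> 0" "\<gamma>2 1 = \<beta> 1" "lip_path M \<beta>"
      using that by (auto simp: connecting_paths_def dest: lip_homotopicD(4))
    then show ?thesis using mdist_le_path_len by metis
  qed
  then have "mdist M (\<gamma>1 1) (\<gamma>2 1) \<le> Inf (path_len M ` connecting_paths M \<gamma>1 \<gamma>2)"
    using connecting_paths_nonempty[of M \<gamma>1 \<gamma>2] 1 2 by (intro cInf_greatest) auto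
  then show ?thesis
    using 1 2 by (simp add: lifted_dist_class endpoint_proj_class)
qed

text \<open>The canonical lift of \<open>\<gamma>\<close> with respect to endpoint projection.\<close>
definition truncations :: "'m metric \<Rightarrow> (real \<Rightarrow> 'm) \<Rightarrow> real \<Rightarrow> (real \<Rightarrow> 'm) set" where
  "truncations M \<gamma> = (\<lambda>t. lip_class M (path_segment \<gamma> 0 t))"

lemma truncations_in_path_space:
  "\<lbrakk>lip_path M \<gamma>; \<gamma> 0 = p0; t \<in> {0..1}\<rbrakk> \<Longrightarrow> truncations M \<gamma> t \<in> path_space M p0"
  by (auto simp: truncations_def intro!: in_path_space lip_path_segment)

lemma endpoint_truncations:
  "\<lbrakk>lip_path M \<gamma>; t \<in> {0..1}\<rbrakk> \<Longrightarrow> endpoint_proj (truncations M \<gamma> t) = \<gamma> t"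
  by (simp add: truncations_def endpoint_proj_class lip_path_segment)

lemma truncations_one: "truncations M \<gamma> 1 = lip_class M \<gamma>"
  by (simp add: truncations_def path_segment_def)

lemma truncations_zero: "truncations M \<gamma> 0 = path_space_base M (\<gamma> 0)"
  by (simp add: truncations_def path_space_base_def path_segment_def)

text \<open>The part of \<open>\<gamma>\<close> between times \<open>s\<close> and \<open>t\<close> connects the two truncations, so the canonical lift does
not increase length.\<close>
lemma lifted_dist_truncations_le:
  assumes \<gamma>: "lip_path M \<gamma>" "\<gamma> 0 = p0" and st: "0 \<le> s" "s \<le> t" "t \<le> 1"
  shows "lifted_dist M p0 (truncations M \<gamma> s) (truncations M \<gamma> t) \<le> variation M \<gamma> s t"
proof -
  have "lifted_dist M p0 (truncations M \<gamma> s) (truncations M \<gamma> t) \<le> path_len M (path_segment \<gamma> s t)"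
    unfolding truncations_def
  proof (rule lifted_dist_le)
    show "path_segment \<gamma> s t \<in> connecting_paths M (path_segment \<gamma> 0 s) (path_segment \<gamma> 0 t)"
      using st by (auto simp: connecting_paths_def intro!: lip_path_segment concat_segments \<gamma>)
  qed (use \<gamma> st in \<open>auto intro!: lip_path_segment\<close>)
  also have "\<dots> \<le> variation M \<gamma> s t"
    using \<gamma>(1) st by (rule path_len_segment_le)
  finally show ?thesis .
qed

lemma variation_concat_second_half:
  assumes "\<gamma> 1 = \<beta> 0" "lip_path M \<beta>"
  shows "variation M (concat_path \<gamma> \<beta>) (1/2) 1 \<le> path_len M \<beta>"
proof (rule variation_least)
  fix v assume "v \<in> variation_sums M (concat_path \<gamma> \<beta>) (1/2) 1"
  then obtain t n where t: "v = (\<Sum>i<n. mdist M (concat_path \<gamma> \<beta> (t i)) (concat_path \<gamma> \<beta> (t (Suc i))))"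
    "t 0 = 1/2" "t n = 1" "\<And>i. i < n \<Longrightarrow> t i \<le> t (Suc i)"
    unfolding variation_sums_def by blast
  have half: "concat_path \<gamma> \<beta> x = \<beta> (2 * x - 1)" if "1/2 \<le> x" for x
  proof (cases "x = 1/2")
    case True show ?thesis using assms(1) by (simp add: True concat_path_def)
  qed (use that in \<open>auto simp: concat_path_def\<close>)
  have "concat_path \<gamma> \<beta> (t i) = \<beta> (2 * t i - 1)" if "i \<le> n" for i
    using partition_bounds[of n t i] t that by (intro half) auto
  then have "v = (\<Sum>i<n. mdist M (\<beta> (2 * t i - 1)) (\<beta> (2 * t (Suc i) - 1)))"
    unfolding t(1) by (intro sum.cong) auto
  also have "\<dots> \<in> variation_sums M \<beta> 0 1"
    by (rule variation_sumsI) (use t in auto)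
  finally show "v \<le> path_len M \<beta>"
    unfolding path_len_eq_variation using assms(2) by (intro variation_upper) auto
qed simp

lemma quasi_convex_unit_interval: "quasi_convex unit_interval"
  unfolding quasi_convex_def quasi_convex_with_def
proof (intro exI[of _ 1] conjI ballI)
  fix x y assume xy: "x \<in> mspace unit_interval" "y \<in> mspace unit_interval"
  have "mdist unit_interval (x + s * (y - x)) (x + t * (y - x)) \<le> \<bar>y - x\<bar> * (t - s)" if "s \<le> t" for s t
  proof -
    have "(x + s * (y - x)) - (x + t * (y - x)) = (s - t) * (y - x)" by (simp add: algebra_simps)
    then show ?thesis using that by (simp add: dist_real_def abs_mult)
  qed
  then have "path_len unit_interval (\<lambda>u. x + u * (y - x)) \<le> \<bar>y - x\<bar> * (1 - 0)"
    unfolding path_len_eq_variation by (intro variation_le) auto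
  then show "\<exists>\<gamma>. lip_path unit_interval \<gamma> \<and> \<gamma> 0 = x \<and> \<gamma> 1 = y \<and>
      path_len unit_interval \<gamma> \<le> 1 * mdist unit_interval x y"
    using xy by (intro exI[of _ "\<lambda>u. x + u * (y - x)"]) (auto simp: dist_real_def intro!: lip_path_affine)
qed auto

section \<open>The universal path space as a length space\<close>

locale universal_path_space =
  fixes M :: "'m metric" and p0 :: 'm
  assumes base_point: "p0 \<in> mspace M"
    and metric: "Metric_space (path_space M p0) (lifted_dist M p0)"
begin

abbreviation P where "P \<equiv> path_space_metric M p0"

lemma mspace_P [simp]: "mspace P = path_space M p0"
  unfolding path_space_metric_def by (rule Metric_space.mspace_metric[OF metric])

lemma mdist_P [simp]: "mdist P = lifted_dist M p0"
  unfolding path_space_metric_def by (rule Metric_space.mdist_metric[OF metric])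

lemma base_in_path_space: "path_space_base M p0 \<in> path_space M p0"
  unfolding path_space_base_def using base_point by (auto intro!: in_path_space lip_path_const)

lemma endpoint_base [simp]: "endpoint_proj (path_space_base M p0) = p0"
  by (simp add: path_space_base_def endpoint_proj_class lip_path_const base_point)

lemma endpoint_in_mspace: "A \<in> path_space M p0 \<Longrightarrow> endpoint_proj A \<in> mspace M"
  by (erule path_spaceE) (auto simp: endpoint_proj_class lip_path_in_mspace)

lemma based_lip_map_endpoint: "based_lip_map P (path_space_base M p0) M p0 endpoint_proj"
  unfolding based_lip_map_def
  by (auto simp: base_in_path_space base_point endpoint_in_mspace mdist_endpoint_le
      intro!: Lipschitz_continuous_mapI[where L = 1])

lemma lip_path_truncations:
  assumes \<gamma>: "lip_path M \<gamma>" "\<gamma> 0 = p0"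
  shows "lip_path P (truncations M \<gamma>)"
  using \<gamma>(1)
proof (rule lip_pathE)
  fix L assume L: "\<And>s t. \<lbrakk>s \<in> {0..1}; t \<in> {0..1}\<rbrakk> \<Longrightarrow> mdist M (\<gamma> s) (\<gamma> t) \<le> L * \<bar>s - t\<bar>"
  show ?thesis
  proof (rule lip_pathI[where L = L])
    fix s t :: real assume st: "s \<in> {0..1}" "t \<in> {0..1}" "s \<le> t"
    have "lifted_dist M p0 (truncations M \<gamma> s) (truncations M \<gamma> t) \<le> variation M \<gamma> s t"
      using st by (intro lifted_dist_truncations_le \<gamma>) auto
    also have "\<dots> \<le> L * (t - s)"
    proof (rule variation_le)
      fix u v assume "s \<le> u" "u \<le> v" "v \<le> t"
      then show "mdist M (\<gamma> u) (\<gamma> v) \<le> L * (v - u)" using L[of u v] st by auto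
    qed (rule st)
    finally show "mdist P (truncations M \<gamma> s) (truncations M \<gamma> t) \<le> L * (t - s)" by simp
  qed (use truncations_in_path_space[OF \<gamma>] in auto)
qed

text \<open>For classes of \<open>\<gamma>1\<close> and \<open>\<gamma>2\<close> and a connecting path \<open>\<beta>\<close> of almost minimal length, the truncations of
\<open>\<gamma>1 * \<beta>\<close> at the times in \<open>[1/2,1]\<close> form a path between the classes that is not longer than \<open>\<beta>\<close>. A
factor \<open>C > 1\<close> leaves room for the choice of \<open>\<beta>\<close> because distinct classes have positive distance.\<close>
lemma quasi_convex_with_P:
  assumes C: "1 < C"
  shows "quasi_convex_with C P"
  unfolding quasi_convex_with_def
proof (intro ballI)
  fix A B assume AB: "A \<in> mspace P" "B \<in> mspace P"
  show "\<exists>\<sigma>. lip_path P \<sigma> \<and> \<sigma> 0 = A \<and> \<sigma> 1 = B \<and> path_len P \<sigma> \<le> C * mdist P A B"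
  proof (cases "A = B")
    case True
    have "path_len P (\<lambda>_. A) \<le> 0 * (1 - 0)"
      unfolding path_len_eq_variation using AB
      by (intro variation_le) (auto simp: Metric_space.mdist_zero[OF metric])
    then show ?thesis
      using AB True lip_path_const[of A P] by (intro exI[of _ "\<lambda>_. A"]) (auto simp: Metric_space.mdist_zero[OF metric])
  next
    case False
    obtain \<gamma>1 where 1: "A = lip_class M \<gamma>1" "lip_path M \<gamma>1" "\<gamma>1 0 = p0"
      using AB path_spaceE by (metis mspace_P)
    obtain \<gamma>2 where 2: "B = lip_class M \<gamma>2" "lip_path M \<gamma>2" "\<gamma>2 0 = p0"
      using AB path_spaceE by (metis mspace_P)
    have "0 < lifted_dist M p0 A B"
      using False AB Metric_space.mdist_pos_less[OF metric] by simp
    then have "lifted_dist M p0 A B < C * lifted_dist M p0 A B" using C by simp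
    then obtain \<beta> where "\<beta> \<in> connecting_paths M \<gamma>1 \<gamma>2" and len: "path_len M \<beta> < C * lifted_dist M p0 A B"
      using lifted_dist_approx 1 2 by metis
    then have \<beta>: "lip_path M \<beta>" "\<gamma>1 1 = \<beta> 0" "lip_homotopic M (concat_path \<gamma>1 \<beta>) \<gamma>2"
      by (auto simp: connecting_paths_def)
    define \<delta> where "\<delta> = concat_path \<gamma>1 \<beta>"
    have \<delta>: "lip_path M \<delta>" "\<delta> 0 = p0" using 1 \<beta> by (auto simp: \<delta>_def intro: lip_path_concat)
    define \<sigma> where "\<sigma> = truncations M \<delta> \<circ> (\<lambda>t. 1/2 + t * (1 - 1/2))"
    have "lip_path P \<sigma>"
      unfolding \<sigma>_def by (intro lip_path_reparam lip_path_truncations lip_path_affine \<delta>) auto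
    moreover have "\<sigma> 0 = A"
    proof -
      have "lip_homotopic M (path_segment \<delta> 0 (1/2)) (path_segment \<delta> 0 (1/2))"
        by (intro lip_homotopic_refl lip_path_segment \<delta>) auto
      then have "lip_homotopic M (path_segment \<delta> 0 (1/2)) \<gamma>1"
        by (rule lip_homotopic_cong) (auto simp: path_segment_def \<delta>_def concat_path_def)
      then show ?thesis by (simp add: \<sigma>_def truncations_def 1 lip_class_eqI)
    qed
    moreover have "\<sigma> 1 = B"
      using \<beta>(3) by (simp add: \<sigma>_def truncations_one 2 \<delta>_def lip_class_eqI)
    moreover have "path_len P \<sigma> \<le> variation M \<delta> (1/2) 1"
      unfolding path_len_eq_variation[of P]
    proof (rule variation_least)
      fix v assume "v \<in> variation_sums P \<sigma> 0 1"
      then obtain t n where t: "v = (\<Sum>i<n. mdist P (\<sigma> (t i)) (\<sigma> (t (Suc i))))"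
        "t 0 = 0" "t n = 1" "\<And>i. i < n \<Longrightarrow> t i \<le> t (Suc i)"
        unfolding variation_sums_def by blast
      define s where "s = (\<lambda>i. 1/2 + t i * (1 - 1/2))"
      have "v \<le> (\<Sum>i<n. variation M \<delta> (s i) (s (Suc i)))"
        unfolding t(1)
      proof (rule sum_mono)
        fix i assume i: "i \<in> {..<n}"
        have "lifted_dist M p0 (truncations M \<delta> (s i)) (truncations M \<delta> (s (Suc i))) \<le> variation M \<delta> (s i) (s (Suc i))"
          using i t partition_bounds[of n t i] partition_bounds[of n t "Suc i"]
          by (intro lifted_dist_truncations_le \<delta>) (auto simp: s_def)
        then show "mdist P (\<sigma> (t i)) (\<sigma> (t (Suc i))) \<le> variation M \<delta> (s i) (s (Suc i))"
          by (simp add: \<sigma>_def s_def)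
      qed
      also have "\<dots> \<le> variation M \<delta> (s 0) (s n)"
        using t by (intro sum_variation_le \<delta>) (auto simp: s_def)
      finally show "v \<le> variation M \<delta> (1/2) 1" by (simp add: s_def t)
    qed simp
    moreover have "variation M \<delta> (1/2) 1 \<le> path_len M \<beta>"
      unfolding \<delta>_def using \<beta> by (intro variation_concat_second_half)
    ultimately show ?thesis using len by (intro exI[of _ \<sigma>]) auto
  qed
qed

lemma length_space_P: "length_space P"
  by (simp add: length_space_def quasi_convex_with_P)

lemma quasi_convex_P: "quasi_convex P"
  unfolding quasi_convex_def using quasi_convex_with_P[of 2] by (intro exI[of _ 2]) auto

text \<open>A loop \<open>\<sigma>\<close> in the path space and the truncations of its projection \<open>f\<close> are both lifts of \<open>f\<close>, as a map
on the interval. By uniqueness of lifts they agree at time \<open>1\<close>, where \<open>\<sigma>\<close> is the base point and the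
truncations give the class of \<open>f\<close>. Hence \<open>f\<close> is null-homotopic.\<close>
lemma endpoint_null_on_loops:
  fixes i :: "real \<Rightarrow> 'x"
  assumes ulp: "unique_lifting_property TYPE('x) P (path_space_base M p0) M p0 endpoint_proj"
    and i: "inj_on i {0..1}"
  shows "null_on_loops P (path_space_base M p0) M endpoint_proj"
  unfolding null_on_loops_def
proof (intro allI impI)
  fix \<sigma> assume "lip_path P \<sigma> \<and> \<sigma> 0 = path_space_base M p0 \<and> \<sigma> 1 = path_space_base M p0"
  then have \<sigma>: "lip_path P \<sigma>" "\<sigma> 0 = path_space_base M p0" "\<sigma> 1 = path_space_base M p0" by auto
  define f where "f = endpoint_proj \<circ> \<sigma>"
  have f: "lip_path M f" "f 0 = p0"
    using lip_path_compose[OF \<sigma>(1)] based_lip_map_endpoint \<sigma>(2) by (auto simp: f_def based_lip_map_def)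
  have null: "null_on_loops unit_interval 0 M f"
    unfolding null_on_loops_def
  proof (intro allI impI)
    fix \<alpha> assume \<alpha>: "lip_path unit_interval \<alpha> \<and> \<alpha> 0 = 0 \<and> \<alpha> 1 = 0"
    have "lip_homotopic M (f \<circ> \<alpha>) (f \<circ> (\<lambda>_. 0))"
      using \<alpha> by (intro lip_homotopic_reparam f lip_path_const) auto
    then show "lip_homotopic M (f \<circ> \<alpha>) (\<lambda>_. f 0)" by (simp add: o_def)
  qed
  have "\<sigma> 1 = truncations M f 1"
  proof (rule lift_unique_copy[OF _ ulp quasi_convex_unit_interval _ null])
    show "inj_on i (mspace unit_interval)" using i by simp
    show "based_lip_map unit_interval 0 M p0 f"
      using f base_point by (simp add: based_lip_map_def lip_path_def)
    show "is_lift unit_interval 0 P (path_space_base M p0) endpoint_proj f \<sigma>"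
      using \<sigma> base_in_path_space by (simp add: is_lift_def based_lip_map_def lip_path_def f_def)
    show "is_lift unit_interval 0 P (path_space_base M p0) endpoint_proj f (truncations M f)"
      using lip_path_truncations[OF f] base_in_path_space truncations_zero[of M f] f endpoint_truncations[OF f(1)]
      by (simp add: is_lift_def based_lip_map_def flip: lip_path_def)
  qed simp
  then have "lip_class M (\<lambda>_. p0) = lip_class M f"
    using \<sigma>(3) by (simp add: truncations_one path_space_base_def)
  then have "lip_homotopic M f (\<lambda>_. p0)"
    using lip_class_eq_iff[OF f(1)] by metis
  then show "lip_homotopic M (endpoint_proj \<circ> \<sigma>) (\<lambda>_. endpoint_proj (path_space_base M p0))"
    by (simp add: f_def)
qed

section \<open>Comparison with a simply connected space over the base\<close>

text \<open>The map sends \<open>x\<close> to the class of \<open>r \<circ> \<alpha>\<close>, where \<open>\<alpha>\<close> is a path from \<open>e0\<close> to \<open>x\<close>. As \<open>E\<close> is simply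
connected, the choice of \<open>\<alpha>\<close> does not matter, and the image under \<open>r\<close> of any path from \<open>x\<close> to \<open>y\<close>
connects the two values. Bounding the distance of the values by the length of that image,
rather than by a constant times the distance of \<open>x\<close> and \<open>y\<close>, lets the map inherit the Lipschitz
constant of \<open>r\<close> as a bound when \<open>E\<close> is a length space.\<close>
lemma path_class_map:
  assumes E: "lip_simply_connected E" "e0 \<in> mspace E" and r: "based_lip_map E e0 M p0 r"
  obtains \<Phi> where "\<Phi> e0 = path_space_base M p0"
    and "\<And>x. x \<in> mspace E \<Longrightarrow> \<Phi> x \<in> path_space M p0"
    and "\<And>x. x \<in> mspace E \<Longrightarrow> endpoint_proj (\<Phi> x) = r x"
    and "\<And>\<gamma>. lip_path E \<gamma> \<Longrightarrow> lifted_dist M p0 (\<Phi> (\<gamma> 0)) (\<Phi> (\<gamma> 1)) \<le> path_len M (r \<circ> \<gamma>)"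
proof -
  have lr: "Lipschitz_continuous_map E M r" and r0: "r e0 = p0"
    using r by (auto simp: based_lip_map_def)
  have "\<forall>x\<in>mspace E. \<exists>\<alpha>. lip_path E \<alpha> \<and> \<alpha> 0 = e0 \<and> \<alpha> 1 = x"
    using E by (auto simp: lip_simply_connected_def lip_path_connected_def)
  then obtain \<alpha> where "\<forall>x\<in>mspace E. lip_path E (\<alpha> x) \<and> \<alpha> x 0 = e0 \<and> \<alpha> x 1 = x"
    using bchoice by metis
  then have \<alpha>: "lip_path E (\<alpha> x)" "\<alpha> x 0 = e0" "\<alpha> x 1 = x" if "x \<in> mspace E" for x
    using that by auto
  have r\<alpha>: "lip_path M (r \<circ> \<alpha> x)" "(r \<circ> \<alpha> x) 0 = p0" if "x \<in> mspace E" for x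
    using lip_path_compose[OF \<alpha>(1)[OF that] lr] \<alpha>(2)[OF that] r0 by auto
  show thesis
  proof (rule that[of "\<lambda>x. lip_class M (r \<circ> \<alpha> x)"])
    have "lip_homotopic E (\<alpha> e0) (\<lambda>_. e0)"
      using \<alpha>[OF E(2)] E by (intro lip_simply_connected_homotopic[OF E(1)] lip_path_const) auto
    from lip_homotopic_compose[OF this lr]
    show "lip_class M (r \<circ> \<alpha> e0) = path_space_base M p0"
      unfolding path_space_base_def by (intro lip_class_eqI) (simp add: o_def r0)
  next
    fix x assume x: "x \<in> mspace E"
    show "lip_class M (r \<circ> \<alpha> x) \<in> path_space M p0"
      using r\<alpha>[OF x] by (rule in_path_space)
    show "endpoint_proj (lip_class M (r \<circ> \<alpha> x)) = r x"
      using r\<alpha>[OF x] \<alpha>[OF x] by (simp add: endpoint_proj_class)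
  next
    fix \<gamma> assume \<gamma>: "lip_path E \<gamma>"
    have ends: "\<gamma> 0 \<in> mspace E" "\<gamma> 1 \<in> mspace E" using lip_path_in_mspace[OF \<gamma>] by auto
    show "lifted_dist M p0 (lip_class M (r \<circ> \<alpha> (\<gamma> 0))) (lip_class M (r \<circ> \<alpha> (\<gamma> 1))) \<le> path_len M (r \<circ> \<gamma>)"
    proof (rule lifted_dist_le)
      have "lip_homotopic E (concat_path (\<alpha> (\<gamma> 0)) \<gamma>) (\<alpha> (\<gamma> 1))"
        using \<alpha> ends \<gamma> by (intro lip_simply_connected_homotopic[OF E(1)] lip_path_concat) auto
      from lip_homotopic_compose[OF this lr]
      have "lip_homotopic M (concat_path (r \<circ> \<alpha> (\<gamma> 0)) (r \<circ> \<gamma>)) (r \<circ> \<alpha> (\<gamma> 1))"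
        by (rule lip_homotopic_cong) (auto simp: concat_path_def)
      then show "r \<circ> \<gamma> \<in> connecting_paths M (r \<circ> \<alpha> (\<gamma> 0)) (r \<circ> \<alpha> (\<gamma> 1))"
        using lip_path_compose[OF \<gamma> lr] \<alpha>[OF ends(1)] by (simp add: connecting_paths_def)
    qed (use r\<alpha>[OF ends(1)] r\<alpha>[OF ends(2)] in auto)
  qed
qed

end

lemma lip_simply_connected_null_on_loops:
  assumes "lip_simply_connected E" "e0 \<in> mspace E" "Lipschitz_continuous_map E M r"
  shows "null_on_loops E e0 M r"
  unfolding null_on_loops_def
proof (intro allI impI)
  fix \<alpha> assume \<alpha>: "lip_path E \<alpha> \<and> \<alpha> 0 = e0 \<and> \<alpha> 1 = e0"
  have "lip_homotopic E \<alpha> (\<lambda>_. e0)"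
    using \<alpha> assms(2) by (intro lip_simply_connected_homotopic[OF assms(1)] lip_path_const) auto
  from lip_homotopic_compose[OF this assms(3)]
  show "lip_homotopic M (r \<circ> \<alpha>) (\<lambda>_. r e0)" by (simp add: o_def)
qed

theorem theorem3p11:
  fixes M :: "'m metric" and p0 :: 'm
    and E :: "'e metric" and e0 :: 'e
    and r :: "'e \<Rightarrow> 'm"
  assumes "p0 \<in> mspace M"
    and "lip_path_connected M"
    and "\<exists>x\<in>mspace M. \<exists>y\<in>mspace M. x \<noteq> y"
    and "Metric_space (path_space M p0) (lifted_dist M p0)"
    and "unique_lifting_property TYPE(('e, 'm) test_point)
           (path_space_metric M p0) (path_space_base M p0) M p0 endpoint_proj"
    and "e0 \<in> mspace E"
    and "lip_simply_connected E"
    and "quasi_convex E"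
    and "based_lip_map E e0 M p0 r"
    and "unique_lifting_property TYPE(('e, 'm) test_point) E e0 M p0 r"
  shows "(\<exists>\<Phi>. biLipschitz_bijection E (path_space_metric M p0) \<Phi> \<and>
            \<Phi> e0 = path_space_base M p0 \<and>
            (\<forall>x\<in>mspace E. endpoint_proj (\<Phi> x) = r x))
       \<and> (geodesic_space M \<and> length_space E \<and> lip_const E M r = 1 \<and>
            lifts_preserve_Lip TYPE(('e, 'm) test_point) E e0 M p0 r \<longrightarrow>
          isometric_spaces E (path_space_metric M p0))"
proof -
  interpret universal_path_space M p0
    by (rule universal_path_space.intro[OF assms(1,4)])
  let ?b = "path_space_base M p0"
  \<comment> \<open>Two distinct points give an injection of the interval into the type of test points: \<open>t\<close> goes
    to the set whose only member is a function that singles out \<open>t\<close>.\<close>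
  obtain x y where "x \<in> mspace M" "y \<in> mspace M" "x \<noteq> y" using assms(3) by blast
  define i :: "real \<Rightarrow> ('e, 'm) test_point" where "i = (\<lambda>t. Inr {\<lambda>u. if u = t then x else y})"
  have i: "inj_on i {0..1}"
    using \<open>x \<noteq> y\<close> by (auto simp: i_def inj_on_def fun_eq_iff)
  have null_P: "null_on_loops P ?b M endpoint_proj"
    using assms(5) i by (rule endpoint_null_on_loops)
  have lr: "Lipschitz_continuous_map E M r" and r0: "r e0 = p0"
    using assms(9) by (auto simp: based_lip_map_def)
  have null_E: "null_on_loops E e0 M r"
    using assms(7,6) lr by (rule lip_simply_connected_null_on_loops)

  obtain \<Phi> where \<Phi>: "\<Phi> e0 = ?b" "\<And>x. x \<in> mspace E \<Longrightarrow> \<Phi> x \<in> path_space M p0"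
    "\<And>x. x \<in> mspace E \<Longrightarrow> endpoint_proj (\<Phi> x) = r x"
    "\<And>\<gamma>. lip_path E \<gamma> \<Longrightarrow> lifted_dist M p0 (\<Phi> (\<gamma> 0)) (\<Phi> (\<gamma> 1)) \<le> path_len M (r \<circ> \<gamma>)"
    using path_class_map[OF assms(7,6,9)] by blast
  \<comment> \<open>The constant \<open>C\<close> is kept variable: some \<open>C\<close> shows that \<open>\<Phi>\<close> is Lipschitz, and letting \<open>C\<close> tend
    to \<open>1\<close> in a length space gives the sharp constant.\<close>
  have \<Phi>_bound: "lifted_dist M p0 (\<Phi> x) (\<Phi> y) \<le> lip_const E M r * C * mdist E x y"
    if xy: "quasi_convex_with C E" "x \<in> mspace E" "y \<in> mspace E" for C x y
  proof -
    obtain \<gamma> where \<gamma>: "lip_path E \<gamma>" "\<gamma> 0 = x" "\<gamma> 1 = y" "path_len E \<gamma> \<le> C * mdist E x y"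
      using xy unfolding quasi_convex_with_def by blast
    have "lifted_dist M p0 (\<Phi> x) (\<Phi> y) \<le> path_len M (r \<circ> \<gamma>)"
      using \<Phi>(4)[OF \<gamma>(1)] \<gamma> by simp
    also have "\<dots> \<le> lip_const E M r * path_len E \<gamma>"
      using lip_const_bound[OF lr] by (intro path_len_compose_le \<gamma>) auto
    also have "\<dots> \<le> lip_const E M r * (C * mdist E x y)"
      using lip_const_bound(1)[OF lr] \<gamma>(4) by (intro mult_left_mono)
    finally show ?thesis by (simp add: mult.assoc)
  qed
  obtain C where C: "quasi_convex_with C E" using assms(8) by (auto simp: quasi_convex_def)
  have l\<Phi>: "Lipschitz_continuous_map E P \<Phi>"
    by (rule Lipschitz_continuous_mapI[where L = "lip_const E M r * C"]) (auto simp: \<Phi> \<Phi>_bound[OF C])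

  obtain \<Psi> where \<Psi>: "is_lift P ?b E e0 r endpoint_proj \<Psi>"
    using lift_exists_copy[OF inj_Inr[THEN inj_on_subset, OF subset_UNIV] assms(10) quasi_convex_P based_lip_map_endpoint null_P]
    by blast
  then have l\<Psi>: "Lipschitz_continuous_map P E \<Psi>" and \<Psi>0: "\<Psi> ?b = e0"
    and r\<Psi>: "\<And>A. A \<in> path_space M p0 \<Longrightarrow> r (\<Psi> A) = endpoint_proj A"
    by (auto simp: is_lift_def based_lip_map_def)
  have \<Psi>_in: "\<Psi> A \<in> mspace E" if "A \<in> path_space M p0" for A
    using Lipschitz_continuous_map_image[OF l\<Psi>] that by auto

  \<comment> \<open>Both composites are lifts of the projection on their space, and so is the identity.\<close>
  have \<Psi>\<Phi>: "\<Psi> (\<Phi> x) = x" if "x \<in> mspace E" for x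
  proof -
    have "is_lift E e0 E e0 r r (\<Psi> \<circ> \<Phi>)" "is_lift E e0 E e0 r r (\<lambda>x. x)"
      using Lipschitz_continuous_map_compose[OF l\<Phi> l\<Psi>] assms(6) \<Phi> \<Psi>0 r\<Psi>
      by (auto simp: is_lift_def based_lip_map_def Lipschitz_continuous_map_id)
    from lift_unique_copy[OF inj_Inl[THEN inj_on_subset, OF subset_UNIV] assms(10,8,9) null_E this that]
    show ?thesis by simp
  qed
  have \<Phi>\<Psi>: "\<Phi> (\<Psi> A) = A" if "A \<in> path_space M p0" for A
  proof -
    have "is_lift P ?b P ?b endpoint_proj endpoint_proj (\<Phi> \<circ> \<Psi>)"
      "is_lift P ?b P ?b endpoint_proj endpoint_proj (\<lambda>A. A)"
      using Lipschitz_continuous_map_compose[OF l\<Psi> l\<Phi>] base_in_path_space \<Phi> \<Psi>0 \<Psi>_in r\<Psi>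
      by (auto simp: is_lift_def based_lip_map_def Lipschitz_continuous_map_id)
    from lift_unique_copy[OF inj_Inr[THEN inj_on_subset, OF subset_UNIV] assms(5) quasi_convex_P based_lip_map_endpoint null_P this, of A]
    show ?thesis using that by simp
  qed
  have bij: "bij_betw \<Phi> (mspace E) (mspace P)"
    by (rule bij_betw_byWitness[where f' = \<Psi>]) (auto simp: \<Psi>\<Phi> \<Phi>\<Psi> \<Phi> \<Psi>_in)
  have "Lipschitz_continuous_map P E (inv_into (mspace E) \<Phi>)"
    using l\<Psi>
  proof (rule Lipschitz_continuous_map_eq)
    fix A assume "A \<in> mspace P"
    then show "\<Psi> A = inv_into (mspace E) \<Phi> A"
      using bij \<Psi>_in \<Phi>\<Psi> by (metis bij_betw_def inv_into_f_eq mspace_P)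
  qed
  then have biLip: "biLipschitz_bijection E P \<Phi>"
    using bij l\<Phi> by (simp add: biLipschitz_bijection_def)

  have "isometric_spaces E P"
    if "length_space E" "lip_const E M r = 1" "lifts_preserve_Lip TYPE(('e, 'm) test_point) E e0 M p0 r"
  proof -
    have \<Phi>_le: "lifted_dist M p0 (\<Phi> x) (\<Phi> y) \<le> mdist E x y" if xy: "x \<in> mspace E" "y \<in> mspace E" for x y
    proof (cases "mdist E x y = 0")
      case True
      then show ?thesis using \<Phi>_bound[OF C xy] by simp
    next
      case False
      then have pos: "0 < mdist E x y" using mdist_nonneg[of E x y] by linarith
      have "lifted_dist M p0 (\<Phi> x) (\<Phi> y) / mdist E x y \<le> K" if "1 < K" for K
        using \<Phi>_bound[of K x y] \<open>length_space E\<close> \<open>lip_const E M r = 1\<close> that xy pos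
        by (simp add: length_space_def divide_le_eq)
      then have "lifted_dist M p0 (\<Phi> x) (\<Phi> y) / mdist E x y \<le> 1"
        by (rule dense_ge)
      then show ?thesis using pos by (simp add: divide_le_eq)
    qed
    have "lip_const P E \<Psi> = lip_const P M endpoint_proj"
      by (rule lift_preserves_Lip_copy[OF inj_Inr[THEN inj_on_subset, OF subset_UNIV] that(3)
            length_space_P based_lip_map_endpoint null_P \<Psi>])
    also have "\<dots> \<le> 1"
      by (rule lip_const_le) (auto simp: mdist_endpoint_le)
    finally have \<Psi>_const: "lip_const P E \<Psi> \<le> 1" .
    have \<Psi>_le: "mdist E (\<Psi> A) (\<Psi> B) \<le> lifted_dist M p0 A B" if "A \<in> path_space M p0" "B \<in> path_space M p0" for A B
      using lip_const_bound(2)[OF l\<Psi>, of A B] that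
        mult_right_mono[OF \<Psi>_const, of "lifted_dist M p0 A B"] Metric_space.nonneg[OF metric, of A B]
      by simp
    have "mdist P (\<Phi> x) (\<Phi> y) = mdist E x y" if "x \<in> mspace E" "y \<in> mspace E" for x y
      using \<Phi>_le[OF that] \<Psi>_le[of "\<Phi> x" "\<Phi> y"] that by (simp add: \<Psi>\<Phi> \<Phi>)
    then show ?thesis using bij unfolding isometric_spaces_def by blast
  qed
  then show ?thesis using biLip \<Phi> by blast
qed

end
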